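(* Let $n\ge 2$, let $\Omega\subset\mathbb{R}^n$ be any nonempty bounded open set, and let $1\le \ell\le n-1$. Then the Babuška–Aziz constant $C_\ell(\Omega)$ is finite if and only if the Friedrichs–Velte constant $\Gamma_\ell(\Omega)$ is finite, and $$C_\ell(\Omega)=\Gamma_\ell(\Omega)+1 .$$
   Context: No regularity of the boundary of $\Omega$ and no topological hypothesis (not even connectedness) is assumed. $\Lambda^k$, $0\le k\le n$, denotes the space of exterior $k$-forms on $\mathbb{R}^n$ with its natural Euclidean norm. $L^2(\Omega,\Lambda^k)$ is the space of differential $k$-forms on $\Omega$ with square integrable coefficients, with norm $\|u\|=(\int_\Omega|u(x)|^2dx)^{1/2}$ and corresponding scalar product $\langle\cdot,\cdot\rangle$; $\mathscr{C}^\infty_0(\Omega,\Lambda^k)$ is the space of smooth $k$-forms with compact support in $\Omega$. $d$ is the exterior derivative, mapping $k$-forms to $(k+1)$-forms, and $d^*$ is its formal adjoint with respect to the $L^2$ scalar product, mapping $k$-forms to $(k-1)$-forms ($d=0$ on $n$-forms, $d^*=0$ on $0$-forms). The $H^1$ semi-norm on $\mathscr{C}^\infty_0(\Omega,\Lambda^\ell)$ is $|u|_1=\langle\Delta u,u\rangle^{1/2}$ with $\Delta=d^*d+dd^*$, so that $|u|_1^2=\|du\|^2+\|d^*u\|^2$. $H^1_0(\Omega,\Lambda^\ell)$ is the completion of $\mathscr{C}^\infty_0(\Omega,\Lambda^\ell)$ under $|\cdot|_1$, and $H^{-1}(\Omega,\Lambda^\ell)$ is its dual space. The operators $d:H^1_0(\Omega,\Lambda^\ell)\to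 L^2(\Omega,\Lambda^{\ell+1})$ and $d^*:H^1_0(\Omega,\Lambda^\ell)\to L^2(\Omega,\Lambda^{\ell-1})$ are the continuous extensions. The operators $d:L^2(\Omega,\Lambda^{\ell-1})\to H^{-1}(\Omega,\Lambda^\ell)$ and $d^*:L^2(\Omega,\Lambda^{\ell+1})\to H^{-1}(\Omega,\Lambda^\ell)$ are defined by duality: $\langle dh,v\rangle=\langle h,d^*v\rangle$ and $\langle d^*g,v\rangle=\langle g,dv\rangle$ for all $v\in H^1_0(\Omega,\Lambda^\ell)$. $M$ is the orthogonal complement in $L^2(\Omega,\Lambda^{\ell-1})$ of the kernel of $d:L^2(\Omega,\Lambda^{\ell-1})\to H^{-1}(\Omega,\Lambda^\ell)$. The operator $d^*$ maps $H^1_0(\Omega,\Lambda^\ell)$ into $M$. Babuška–Aziz constant: $C_\ell(\Omega)$ is the smallest constant $C$ such that for every $q\in M$ there exists $v\in H^1_0(\Omega,\Lambda^\ell)$ with $d^*v=q$ and $|v|_1^2\le C\|q\|^2$; if $d^*:H^1_0(\Omega,\Lambda^\ell)\to M$ is not surjective, $C_\ell(\Omega)=\infty$. Friedrichs–Velte constant: $\Gamma_\ell(\Omega)$ is the smallest constant $\Gamma$ such that $\|h\|^2\le\Gamma\|g\|^2$ for all $h\in M$ and $g\in L^2(\Omega,\Lambda^{\ell+1})$ satisfying $dh=d^*g$ in $H^{-1}(\Omega,\Lambda^\ell)$; if no such constant exists, $\Gamma_\ell(\Omega)=\infty$. *)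

theory Defs
  imports "HOL-Analysis.Analysis"
begin

section \<open>Exterior forms on \<open>\<real>\<^sup>n\<close>\<close>

text \<open>
  \<open>\<real>\<^sup>n\<close> is \<^typ>\<open>real^'n\<close>, where the finite index type is linearly ordered. The exterior algebra of
  \<open>\<real>\<^sup>n\<close> is \<open>real^('n set)\<close>: the coefficient at \<open>I = {i\<^sub>1 < \<dots> < i\<^sub>k}\<close> belongs to the basis form
  \<open>dx\<^sub>I = dx\<^sub>i\<^sub>1 \<and> \<dots> \<and> dx\<^sub>i\<^sub>k\<close>. The library's inner product on this type makes the \<open>dx\<^sub>I\<close> orthonormal,
  which is the natural Euclidean structure.
\<close>

type_synonym 'n form = "real^'n \<Rightarrow> real^('n set)"

definition Lam :: "nat \<Rightarrow> (real^('n::finite set)) set" where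
  "Lam k = {w. \<forall>I. card I \<noteq> k \<longrightarrow> w $ I = 0}"

text \<open>\<open>dx\<^sub>j \<and> dx\<^sub>I = wsign j I \<cdot> dx\<^sub>I\<^sub>\<union>\<^sub>{\<^sub>j\<^sub>}\<close> for \<open>j \<notin> I\<close>.\<close>

definition wsign :: "'n::linorder \<Rightarrow> 'n set \<Rightarrow> real" where
  "wsign j I = (-1) ^ card {i \<in> I. i < j}"

definition dx_wedge :: "'n::{finite,linorder} \<Rightarrow> real^('n set) \<Rightarrow> real^('n set)" where
  "dx_wedge j w = (\<chi> J. if j \<in> J then wsign j (J - {j}) * w $ (J - {j}) else 0)"

text \<open>Contraction with the \<open>j\<close>-th unit vector, i.e. the adjoint of \<^const>\<open>dx_wedge\<close>.\<close>

definition contract :: "'n::{finite,linorder} \<Rightarrow> real^('n set) \<Rightarrow> real^('n set)" where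
  "contract j w = (\<chi> I. if j \<notin> I then wsign j I * w $ (insert j I) else 0)"

lemma dx_wedge_anticommute: "dx_wedge i (dx_wedge j w) = - dx_wedge j (dx_wedge i w)"
proof -
  have ws: "wsign a (insert b K) = (if b < a then - wsign a K else wsign a K)"
    if "b \<notin> K" for a b :: 'a and K
  proof -
    have "{x \<in> insert b K. x < a} =
        (if b < a then insert b {x \<in> K. x < a} else {x \<in> K. x < a})"
      by auto
    then show ?thesis
      using that by (auto simp: wsign_def)
  qed
  show ?thesis
  proof (cases "i = j")
    case True
    then show ?thesis by (auto simp: dx_wedge_def vec_eq_iff)
  next
    case False
    have "dx_wedge i (dx_wedge j w) $ J = - dx_wedge j (dx_wedge i w) $ J" for J
    proof (cases "i \<in> J \<and> j \<in> J")
      case True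
      define K where "K = J - {i, j}"
      have J: "i \<in> J" "j \<in> J" "J - {i} = insert j K" "J - {j} = insert i K"
        and K: "i \<notin> K" "j \<notin> K" "insert j K - {j} = K" "insert i K - {i} = K"
        using True False by (auto simp: K_def)
      have "dx_wedge i (dx_wedge j w) $ J = wsign i (insert j K) * (wsign j K * w $ K)"
        "dx_wedge j (dx_wedge i w) $ J = wsign j (insert i K) * (wsign i K * w $ K)"
        by (simp_all add: dx_wedge_def J K(3,4))
      then show ?thesis
        using False by (auto simp: ws[OF K(1)] ws[OF K(2)])
    next
      case False
      then show ?thesis by (auto simp: dx_wedge_def)
    qed
    then show ?thesis by (simp add: vec_eq_iff)
  qed
qed

lemma inner_dx_wedge: "dx_wedge j w \<bullet> z = w \<bullet> contract j z"
proof -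
  have "dx_wedge j w \<bullet> z = (\<Sum>J\<in>{J. j \<in> J}. wsign j (J - {j}) * w $ (J - {j}) * z $ J)"
    unfolding inner_vec_def dx_wedge_def by (intro sum.mono_neutral_cong_right) auto
  also have "\<dots> = (\<Sum>I\<in>{I. j \<notin> I}. w $ I * (wsign j I * z $ (insert j I)))"
    by (rule sum.reindex_bij_witness[of _ "insert j" "\<lambda>J. J - {j}"]) (auto simp: insert_absorb)
  also have "\<dots> = w \<bullet> contract j z"
    unfolding inner_vec_def contract_def by (intro sum.mono_neutral_cong_left) auto
  finally show ?thesis .
qed


section \<open>Smooth forms, exterior derivative and codifferential\<close>

definition partial :: "'n::finite \<Rightarrow> (real^'n \<Rightarrow> 'b::real_normed_vector) \<Rightarrow> real^'n \<Rightarrow> 'b" where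
  "partial j f x = frechet_derivative f (at x) (axis j 1)"

fun Ck :: "nat \<Rightarrow> (real^'n::finite \<Rightarrow> 'b::real_normed_vector) \<Rightarrow> bool" where
  "Ck 0 f \<longleftrightarrow> continuous_on UNIV f"
| "Ck (Suc k) f \<longleftrightarrow> (\<forall>x. f differentiable (at x)) \<and> (\<forall>j. Ck k (partial j f))"

text \<open>\<open>C\<^sub>0\<^sup>\<infinity>(\<Omega>, \<Lambda>\<^sup>k)\<close>; its elements are extended by zero to \<open>\<real>\<^sup>n\<close>.\<close>

definition test_forms :: "(real^'n::finite) set \<Rightarrow> nat \<Rightarrow> 'n form set" where
  "test_forms \<Omega> k = {u. (\<forall>m. Ck m u) \<and> (\<forall>x. u x \<in> Lam k) \<and>
     compact (closure {x. u x \<noteq> 0}) \<and> closure {x. u x \<noteq> 0} \<subseteq> \<Omega>}"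

definition ext_d :: "'n::{finite,linorder} form \<Rightarrow> 'n form" where
  "ext_d u x = (\<Sum>j\<in>UNIV. dx_wedge j (partial j u x))"

text \<open>The formal adjoint of \<^const>\<open>ext_d\<close>; see \<open>ext_d_codiff_adjoint\<close> below.\<close>

definition codiff :: "'n::{finite,linorder} form \<Rightarrow> 'n form" where
  "codiff u x = - (\<Sum>j\<in>UNIV. contract j (partial j u x))"


section \<open>Square integrable forms\<close>

text \<open>
  Elements of \<open>L\<^sup>2(\<Omega>, \<Lambda>\<^sup>k)\<close> are represented by functions, whose values outside \<open>\<Omega>\<close> are irrelevant;
  functions that agree almost everywhere in \<open>\<Omega>\<close> represent the same element.
\<close>

definition L2 :: "(real^'n::finite) set \<Rightarrow> nat \<Rightarrow> 'n form set" where
  "L2 \<Omega> k = {u. u \<in> borel_measurable (lebesgue_on \<Omega>) \<and> (\<forall>x\<in>\<Omega>. u x \<in> Lam k) \<and>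
     integrable (lebesgue_on \<Omega>) (\<lambda>x. (norm (u x))\<^sup>2)}"

definition L2_inner :: "(real^'n::finite) set \<Rightarrow> 'n form \<Rightarrow> 'n form \<Rightarrow> real" where
  "L2_inner \<Omega> u v = (\<integral>x. u x \<bullet> v x \<partial>(lebesgue_on \<Omega>))"

definition L2_norm :: "(real^'n::finite) set \<Rightarrow> 'n form \<Rightarrow> real" where
  "L2_norm \<Omega> u = sqrt (\<integral>x. (norm (u x))\<^sup>2 \<partial>(lebesgue_on \<Omega>))"

lemma partial_along_line:
  fixes f :: "real^'n::finite \<Rightarrow> real"
  assumes "\<forall>x. f differentiable (at x)"
  shows "((\<lambda>t. f (x + t *\<^sub>R axis j 1)) has_real_derivative partial j f (x + t *\<^sub>R axis j 1)) (at t)"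
proof -
  let ?D = "frechet_derivative f (at (x + t *\<^sub>R axis j 1))"
  have D: "(f has_derivative ?D) (at (x + t *\<^sub>R axis j 1))"
    using assms frechet_derivative_works by blast
  have "((\<lambda>t. x + t *\<^sub>R axis j 1) has_derivative (\<lambda>s. s *\<^sub>R axis j 1)) (at t)"
    by (auto intro!: derivative_eq_intros)
  from diff_chain_at[OF this D]
  have "((\<lambda>t. f (x + t *\<^sub>R axis j 1)) has_derivative (\<lambda>s. ?D (s *\<^sub>R axis j 1))) (at t)"
    by (simp add: o_def)
  moreover have "(\<lambda>s. ?D (s *\<^sub>R axis j 1)) = (*) (partial j f (x + t *\<^sub>R axis j 1))"
    using linear_scale[OF has_derivative_linear[OF D]] by (auto simp: partial_def)
  ultimately show ?thesis by (simp add: has_field_derivative_def)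
qed

lemma partial_eq_0_outside:
  fixes f :: "real^'n::finite \<Rightarrow> 'b::real_normed_vector"
  assumes "x \<notin> closure {x. f x \<noteq> 0}"
  shows "partial j f x = 0"
proof -
  have "((\<lambda>_. 0) has_derivative (\<lambda>_. 0)) (at x)" by simp
  moreover have "open (- closure {x. f x \<noteq> 0})" by (rule open_Compl) (rule closed_closure)
  ultimately have "(f has_derivative (\<lambda>_. 0)) (at x)"
    by (rule has_derivative_transform_within_open)
      (use assms closure_subset[of "{x. f x \<noteq> 0}"] in auto)
  then have "frechet_derivative f (at x) = (\<lambda>_. 0)"
    by (metis frechet_derivative_at)
  then show ?thesis by (simp add: partial_def)
qed

lemma integrable_continuous_compact_support:
  fixes f :: "real^'n::finite \<Rightarrow> real"
  assumes "continuous_on UNIV f" "compact S" "\<And>x. x \<notin> S \<Longrightarrow> f x = 0"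
  shows "integrable lborel f"
proof -
  have "(\<lambda>x. indicator S x *\<^sub>R f x) = f"
    using assms(3) by (auto simp: fun_eq_iff indicator_def)
  moreover have "integrable lborel (\<lambda>x. indicator S x *\<^sub>R f x)"
    using assms by (intro borel_integrable_compact) (auto intro: continuous_on_subset)
  ultimately show ?thesis by simp
qed

lemma integral_partial_eq_0:
  fixes f :: "real^'n::finite \<Rightarrow> real"
  assumes diff: "\<forall>x. f differentiable (at x)" and cont: "continuous_on UNIV (partial j f)"
    and comp: "compact (closure {x. f x \<noteq> 0})"
  shows "(\<integral>x. partial j f x \<partial>lborel) = 0"
proof -
  let ?S = "closure {x. f x \<noteq> 0}" and ?e = "axis j 1 :: real^'n"
  obtain R where R: "\<And>x. x \<in> ?S \<Longrightarrow> norm x \<le> R"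
    using compact_imp_bounded[OF comp] unfolding bounded_iff by metis
  have f0: "f x = 0" if "x \<notin> ?S" for x
    using that closure_subset[of "{x. f x \<noteq> 0}"] by auto
  have contf: "continuous_on UNIV f"
    using diff by (simp add: continuous_on_eq_continuous_within differentiable_imp_continuous_within)
  have intf: "integrable lborel f"
    using contf comp f0 by (rule integrable_continuous_compact_support)
  have "compact (partial j f ` ?S)"
    using comp cont by (intro compact_continuous_image) (auto intro: continuous_on_subset)
  then obtain B0 where B0: "\<And>x. x \<in> ?S \<Longrightarrow> \<bar>partial j f x\<bar> \<le> B0"
    using compact_imp_bounded[of "partial j f ` ?S"] unfolding bounded_iff real_norm_def by blast
  define B where "B = max B0 0"
  have B: "\<bar>partial j f x\<bar> \<le> B" for x
    using B0[of x] partial_eq_0_outside[of x f j] by (cases "x \<in> ?S") (auto simp: B_def)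
  define h :: "nat \<Rightarrow> real" where "h m = 1 / real (Suc m)" for m
  have h: "0 < h m" "h m \<le> 1" for m by (auto simp: h_def)
  define s where "s m x = (f (x + h m *\<^sub>R ?e) - f x) / h m" for m x
  have tr: "integrable lborel (\<lambda>x. f (x + h m *\<^sub>R ?e))"
    "(\<integral>x. f (x + h m *\<^sub>R ?e) \<partial>lborel) = (\<integral>x. f x \<partial>lborel)" for m
  proof -
    have meas: "f \<in> borel_measurable borel"
      using contf by (rule borel_measurable_continuous_onI)
    have eq: "(\<lambda>x. f (x + h m *\<^sub>R ?e)) = (\<lambda>x. f ((+) (h m *\<^sub>R ?e) x))"
      by (simp add: add.commute)
    have "integrable (distr lborel borel ((+) (h m *\<^sub>R ?e))) f"
      using intf by (simp only: lborel_distr_plus)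
    then show "integrable lborel (\<lambda>x. f (x + h m *\<^sub>R ?e))"
      unfolding eq using meas by (subst (asm) integrable_distr_eq) auto
    have "integral\<^sup>L (distr lborel borel ((+) (h m *\<^sub>R ?e))) f = integral\<^sup>L lborel f"
      by (simp only: lborel_distr_plus)
    then show "(\<integral>x. f (x + h m *\<^sub>R ?e) \<partial>lborel) = (\<integral>x. f x \<partial>lborel)"
      unfolding eq using meas by (subst (asm) integral_distr) auto
  qed
  have s0: "(\<integral>x. s m x \<partial>lborel) = 0" for m
    unfolding s_def using tr[of m] intf by simp
  have "(\<lambda>m. \<integral>x. s m x \<partial>lborel) \<longlonglongrightarrow> (\<integral>x. partial j f x \<partial>lborel)"
  proof (rule integral_dominated_convergence)
    show "partial j f \<in> borel_measurable lborel"
      using borel_measurable_continuous_onI[OF cont] by simp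
    show "s m \<in> borel_measurable lborel" for m
    proof -
      have "continuous_on UNIV (s m)"
        unfolding s_def
        by (intro continuous_intros continuous_on_compose2[OF contf]) (use h[of m] in auto)
      then show ?thesis using borel_measurable_continuous_onI by simp
    qed
    show "integrable lborel (\<lambda>x. indicator (cball (0::real^'n) (R + 1)) x *\<^sub>R B)"
      by (rule borel_integrable_compact) auto
    show "AE x in lborel. (\<lambda>m. s m x) \<longlonglongrightarrow> partial j f x"
    proof (rule AE_I2)
      fix x
      have "((\<lambda>t. (f (x + t *\<^sub>R ?e) - f x) / t) \<longlongrightarrow> partial j f x) (at 0)"
        using partial_along_line[OF diff, of x j 0] by (simp add: has_field_derivative_iff)
      moreover have "filterlim h (at 0) sequentially"
        unfolding filterlim_at
      proof
        show "h \<longlonglongrightarrow> 0" unfolding h_def by (rule LIMSEQ_Suc[OF lim_1_over_n])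
        show "\<forall>\<^sub>F m in sequentially. h m \<in> UNIV \<and> h m \<noteq> 0" using h(1) by (simp add: less_imp_neq[symmetric])
      qed
      ultimately show "(\<lambda>m. s m x) \<longlonglongrightarrow> partial j f x"
        unfolding s_def by (rule filterlim_compose)
    qed
    show "AE x in lborel. norm (s m x) \<le> indicator (cball (0::real^'n) (R + 1)) x *\<^sub>R B" for m
    proof (rule AE_I2)
      fix x
      show "norm (s m x) \<le> indicator (cball (0::real^'n) (R + 1)) x *\<^sub>R B"
      proof (cases "norm x \<le> R + 1")
        case True
        obtain z where "f (x + h m *\<^sub>R ?e) - f (x + 0 *\<^sub>R ?e) = (h m - 0) * partial j f (x + z *\<^sub>R ?e)"
          using MVT2[OF h(1)[of m], of "\<lambda>t. f (x + t *\<^sub>R ?e)" "\<lambda>t. partial j f (x + t *\<^sub>R ?e)"]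
            partial_along_line[OF diff] by blast
        then have "s m x = partial j f (x + z *\<^sub>R ?e)"
          using h(1)[of m] by (simp add: s_def)
        then show ?thesis using True B by simp
      next
        case False
        have "norm x \<le> norm (x + h m *\<^sub>R ?e) + norm (h m *\<^sub>R ?e)"
          using norm_triangle_ineq4[of "x + h m *\<^sub>R ?e" "h m *\<^sub>R ?e"] by simp
        then have "norm x \<le> norm (x + h m *\<^sub>R ?e) + 1"
          using h[of m] by simp
        then have "\<not> norm (x + h m *\<^sub>R ?e) \<le> R" "\<not> norm x \<le> R"
          using False by auto
        then have "f (x + h m *\<^sub>R ?e) = 0" "f x = 0"
          using R f0 by metis+
        then show ?thesis using False by (simp add: s_def)
      qed
    qed
  qed
  then show ?thesis using s0 by (simp add: LIMSEQ_const_iff)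
qed

lemma linear_contract: "linear (contract j)"
  by (auto intro!: linearI simp: contract_def vec_eq_iff algebra_simps)

lemma linear_dx_wedge: "linear (dx_wedge j)"
  by (auto intro!: linearI simp: dx_wedge_def vec_eq_iff algebra_simps)

lemma ext_d_codiff_adjoint:
  fixes \<Omega> :: "(real^'n::{finite,linorder}) set"
  assumes "open \<Omega>" "u \<in> test_forms \<Omega> k" "v \<in> test_forms \<Omega> (Suc k)"
  shows "L2_inner \<Omega> (ext_d u) v = L2_inner \<Omega> u (codiff v)"
proof -
  have Ck: "Ck m u" "Ck m v" for m
    using assms by (auto simp: test_forms_def)
  have diff: "u differentiable (at x)" "v differentiable (at x)" for x
    using Ck[of 1] by auto
  have cont: "continuous_on UNIV u" "continuous_on UNIV v"
    using Ck[of 0] by auto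
  have contp: "continuous_on UNIV (partial j u)" "continuous_on UNIV (partial j v)" for j
    using Ck[of 1] by auto
  let ?S = "closure {x. u x \<noteq> 0}"
  have S: "compact ?S" "?S \<subseteq> \<Omega>"
    using assms by (auto simp: test_forms_def)
  have u0: "u x = 0" if "x \<notin> ?S" for x
    using that closure_subset[of "{x. u x \<noteq> 0}"] by auto
  have blc: "bounded_linear (contract j)" for j :: 'n
    using linear_contract[of j] unfolding linear_conv_bounded_linear .
  have blw: "bounded_linear (dx_wedge j)" for j :: 'n
    using linear_dx_wedge[of j] unfolding linear_conv_bounded_linear .
  note cc = bounded_linear.continuous_on[OF blc] bounded_linear.continuous_on[OF blw]
  define F where "F x = ext_d u x \<bullet> v x" for x
  define G where "G x = u x \<bullet> codiff v x" for x
  define P where "P j x = u x \<bullet> contract j (v x)" for j x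
  have F0: "F x = 0" if "x \<notin> ?S" for x
    using partial_eq_0_outside[OF that] by (simp add: F_def ext_d_def linear_0[OF linear_dx_wedge])
  have G0: "G x = 0" if "x \<notin> ?S" for x
    using u0[OF that] by (simp add: G_def)
  have cF: "continuous_on UNIV F"
    unfolding F_def ext_d_def by (intro continuous_intros cc cont contp)
  have cG: "continuous_on UNIV G"
    unfolding G_def codiff_def by (intro continuous_intros cc cont contp)
  have dP: "(P j has_derivative (\<lambda>h. u x \<bullet> contract j (frechet_derivative v (at x) h) +
      frechet_derivative u (at x) h \<bullet> contract j (v x))) (at x)" for j x
    unfolding P_def
    using diff[of x] by (intro has_derivative_inner bounded_linear.has_derivative[OF blc])
      (auto simp: frechet_derivative_works)
  have pP: "partial j (P j) x =
      dx_wedge j (partial j u x) \<bullet> v x + u x \<bullet> contract j (partial j v x)" for j x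
    unfolding partial_def frechet_derivative_at[OF dP[of j x], symmetric]
    by (simp add: inner_dx_wedge)
  have P0: "(\<integral>x. partial j (P j) x \<partial>lborel) = 0" "integrable lborel (partial j (P j))" for j
  proof -
    have sub: "{x. P j x \<noteq> 0} \<subseteq> {x. u x \<noteq> 0}" by (auto simp: P_def)
    have c: "continuous_on UNIV (partial j (P j))"
      unfolding pP by (intro continuous_intros cc cont contp)
    have k: "compact (closure {x. P j x \<noteq> 0})"
      using S(1) closure_mono[OF sub] by (metis closed_closure compact_closure compact_eq_bounded_closed bounded_subset)
    show "(\<integral>x. partial j (P j) x \<partial>lborel) = 0"
      using dP c k by (intro integral_partial_eq_0) (auto simp: differentiable_def)
    show "integrable lborel (partial j (P j))"
      using c k by (rule integrable_continuous_compact_support) (rule partial_eq_0_outside)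
  qed
  have FG: "F x - G x = (\<Sum>j\<in>UNIV. partial j (P j) x)" for x
    by (simp add: F_def G_def ext_d_def codiff_def pP inner_sum_left inner_sum_right sum.distrib)
  have intFG: "integrable lborel F" "integrable lborel G"
    using integrable_continuous_compact_support[OF cF S(1) F0]
      integrable_continuous_compact_support[OF cG S(1) G0] by auto
  have "(\<integral>x. F x \<partial>lborel) - (\<integral>x. G x \<partial>lborel) = (\<integral>x. F x - G x \<partial>lborel)"
    using intFG by simp
  also have "\<dots> = 0"
    unfolding FG using P0 by simp
  finally have eq: "(\<integral>x. F x \<partial>lborel) = (\<integral>x. G x \<partial>lborel)" by simp
  have restr: "(\<integral>x. H x \<partial>(lebesgue_on \<Omega>)) = (\<integral>x. H x \<partial>lborel)"
    if "continuous_on UNIV H" "\<And>x. x \<notin> ?S \<Longrightarrow> H x = 0" for H :: "real^'n::{finite,linorder} \<Rightarrow> real"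
  proof -
    have "(\<integral>x. H x \<partial>(lebesgue_on \<Omega>)) = (\<integral>x. indicator \<Omega> x *\<^sub>R H x \<partial>lebesgue)"
      using assms(1) by (intro integral_restrict_space) auto
    also have "(\<lambda>x. indicator \<Omega> x *\<^sub>R H x) = H"
      using that(2) S(2) by (auto simp: fun_eq_iff indicator_def)
    also have "integral\<^sup>L lebesgue H = integral\<^sup>L lborel H"
      using borel_measurable_continuous_onI[OF that(1)] by (intro integral_completion) simp
    finally show ?thesis .
  qed
  show ?thesis
    using eq restr[OF cF F0] restr[OF cG G0] by (simp add: L2_inner_def F_def G_def)
qed


section \<open>The spaces \<open>H\<^sup>1\<^sub>0\<close> and \<open>H\<^sup>-\<^sup>1\<close>\<close>

definition laplace :: "'n::{finite,linorder} form \<Rightarrow> 'n form" where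
  "laplace u x = codiff (ext_d u) x + ext_d (codiff u) x"

definition H1_seminorm :: "(real^'n::{finite,linorder}) set \<Rightarrow> 'n form \<Rightarrow> real" where
  "H1_seminorm \<Omega> u = sqrt (L2_inner \<Omega> (laplace u) u)"

text \<open>
  The completion of \<open>C\<^sub>0\<^sup>\<infinity>(\<Omega>, \<Lambda>\<^sup>l)\<close> for \<^const>\<open>H1_seminorm\<close>. Its elements are represented by
  Cauchy sequences of test forms; as for \<^const>\<open>L2\<close>, no quotient is taken, so two sequences
  whose difference tends to zero represent the same element. The operators below are the
  continuous extensions from the dense subspace of test forms (the constant sequences).
\<close>

definition H10 :: "(real^'n::{finite,linorder}) set \<Rightarrow> nat \<Rightarrow> (nat \<Rightarrow> 'n form) set" where
  "H10 \<Omega> l = {v. (\<forall>m. v m \<in> test_forms \<Omega> l) \<and>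
     (\<forall>e>0. \<exists>N. \<forall>i\<ge>N. \<forall>j\<ge>N. H1_seminorm \<Omega> (\<lambda>x. v i x - v j x) < e)}"

definition H10_norm :: "(real^'n::{finite,linorder}) set \<Rightarrow> (nat \<Rightarrow> 'n form) \<Rightarrow> real" where
  "H10_norm \<Omega> v = lim (\<lambda>m. H1_seminorm \<Omega> (v m))"

definition H10_d ::
  "(real^'n::{finite,linorder}) set \<Rightarrow> nat \<Rightarrow> (nat \<Rightarrow> 'n form) \<Rightarrow> 'n form" where
  "H10_d \<Omega> l v =
     (SOME w. w \<in> L2 \<Omega> (l + 1) \<and> (\<lambda>m. L2_norm \<Omega> (\<lambda>x. ext_d (v m) x - w x)) \<longlonglongrightarrow> 0)"

definition H10_codiff ::
  "(real^'n::{finite,linorder}) set \<Rightarrow> nat \<Rightarrow> (nat \<Rightarrow> 'n form) \<Rightarrow> 'n form" where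
  "H10_codiff \<Omega> l v =
     (SOME w. w \<in> L2 \<Omega> (l - 1) \<and> (\<lambda>m. L2_norm \<Omega> (\<lambda>x. codiff (v m) x - w x)) \<longlonglongrightarrow> 0)"

text \<open>
  The operators \<open>d : L\<^sup>2(\<Omega>, \<Lambda>\<^sup>l\<^sup>-\<^sup>1) \<rightarrow> H\<^sup>-\<^sup>1(\<Omega>, \<Lambda>\<^sup>l)\<close> and \<open>d\<^sup>* : L\<^sup>2(\<Omega>, \<Lambda>\<^sup>l\<^sup>+\<^sup>1) \<rightarrow> H\<^sup>-\<^sup>1(\<Omega>, \<Lambda>\<^sup>l)\<close>.
  Elements of \<open>H\<^sup>-\<^sup>1(\<Omega>, \<Lambda>\<^sup>l)\<close> are functionals on \<^const>\<open>H10\<close>, made extensional by \<^const>\<open>restrict\<close>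
  so that equality in \<open>H\<^sup>-\<^sup>1\<close> is equality of functions.
\<close>

definition Hm1_d ::
  "(real^'n::{finite,linorder}) set \<Rightarrow> nat \<Rightarrow> 'n form \<Rightarrow> (nat \<Rightarrow> 'n form) \<Rightarrow> real" where
  "Hm1_d \<Omega> l h = (\<lambda>v\<in>H10 \<Omega> l. L2_inner \<Omega> h (H10_codiff \<Omega> l v))"

definition Hm1_codiff ::
  "(real^'n::{finite,linorder}) set \<Rightarrow> nat \<Rightarrow> 'n form \<Rightarrow> (nat \<Rightarrow> 'n form) \<Rightarrow> real" where
  "Hm1_codiff \<Omega> l g = (\<lambda>v\<in>H10 \<Omega> l. L2_inner \<Omega> g (H10_d \<Omega> l v))"


section \<open>The two constants\<close>

definition M_space :: "(real^'n::{finite,linorder}) set \<Rightarrow> nat \<Rightarrow> 'n form set" where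
  "M_space \<Omega> l = {q \<in> L2 \<Omega> (l - 1).
     \<forall>h\<in>L2 \<Omega> (l - 1). Hm1_d \<Omega> l h = (\<lambda>v\<in>H10 \<Omega> l. 0) \<longrightarrow> L2_inner \<Omega> q h = 0}"

text \<open>
  In both definitions the infimum of the empty set is \<open>\<infinity>\<close>. For the first constant this covers the
  case that \<open>d\<^sup>*\<close> does not map \<open>H\<^sup>1\<^sub>0\<close> onto \<open>M\<close>.
\<close>

definition babuska_aziz_const :: "(real^'n::{finite,linorder}) set \<Rightarrow> nat \<Rightarrow> ereal" where
  "babuska_aziz_const \<Omega> l = Inf {ereal C | C.
     \<forall>q\<in>M_space \<Omega> l. \<exists>v\<in>H10 \<Omega> l.
       (AE x in lebesgue_on \<Omega>. H10_codiff \<Omega> l v x = q x) \<and>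
       (H10_norm \<Omega> v)\<^sup>2 \<le> C * (L2_norm \<Omega> q)\<^sup>2}"

definition friedrichs_velte_const :: "(real^'n::{finite,linorder}) set \<Rightarrow> nat \<Rightarrow> ereal" where
  "friedrichs_velte_const \<Omega> l = Inf {ereal \<Gamma> | \<Gamma>.
     \<forall>h\<in>M_space \<Omega> l. \<forall>g\<in>L2 \<Omega> (l + 1).
       Hm1_d \<Omega> l h = Hm1_codiff \<Omega> l g \<longrightarrow> (L2_norm \<Omega> h)\<^sup>2 \<le> \<Gamma> * (L2_norm \<Omega> g)\<^sup>2}"

end

theory Submission
  imports Defs
begin

text \<open>
  For test forms \<open>|u|\<^sub>1\<^sup>2 = \<parallel>d\<^sup>*u\<parallel>\<^sup>2 + \<parallel>du\<parallel>\<^sup>2\<close>, so \<open>u \<mapsto> (d\<^sup>*u, du)\<close> identifies \<open>H\<^sup>1\<^sub>0\<close> with a closed subspace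
  \<open>K\<close> of \<open>L\<^sup>2 \<times> L\<^sup>2\<close>, on which \<open>d\<^sup>*\<close> and \<open>d\<close> are the two coordinate projections.

  Given a Babuska--Aziz constant \<open>C\<close> and \<open>dh = d\<^sup>*g\<close>, choose \<open>v\<close> with \<open>d\<^sup>*v = h\<close> and
  \<open>|v|\<^sub>1\<^sup>2 \<le> C\<parallel>h\<parallel>\<^sup>2\<close>; then \<open>\<parallel>dv\<parallel>\<^sup>2 \<le> (C - 1)\<parallel>h\<parallel>\<^sup>2\<close> and \<open>\<parallel>h\<parallel>\<^sup>2 = \<langle>g, dv\<rangle> \<le> \<parallel>g\<parallel> \<parallel>dv\<parallel>\<close>.

  Conversely, let \<open>(Sh, g)\<close> be the orthogonal projection of \<open>(h, 0)\<close> onto \<open>K\<close>, for \<open>h \<in> M\<close>. Then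
  \<open>d(h - Sh) = d\<^sup>*g\<close> and \<open>\<parallel>g\<parallel>\<^sup>2 = \<langle>h - Sh, Sh\<rangle>\<close>, and a Friedrichs--Velte constant \<open>\<Gamma>\<close> yields
  \<open>(1 + \<Gamma>)\<parallel>h - Sh\<parallel> \<le> \<Gamma>\<parallel>h\<parallel>\<close>. Hence \<open>1 - S\<close> is a contraction on \<open>M\<close>, the equation \<open>Sh = q\<close> is
  solvable for every \<open>q \<in> M\<close>, and the corresponding projection is the required element of \<open>H\<^sup>1\<^sub>0\<close>.

  That only \<open>C \<ge> 1\<close> and \<open>\<Gamma> \<ge> 0\<close> are admissible follows from \<open>M \<noteq> 0\<close> (a bump form) and from the
  constant \<open>(l + 1)\<close>-forms, which satisfy \<open>d\<^sup>*g = 0\<close> in \<open>H\<^sup>-\<^sup>1\<close>.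
\<close>


section \<open>The two constants in Hilbert spaces\<close>

text \<open>A sequence in \<open>K\<close> that minimizes the distance to \<open>x\<close> is Cauchy
  by the parallelogram law, and completeness yields a nearest point \<open>p\<close>. If
  \<open>x - p\<close> were not orthogonal to some \<open>k\<close>, moving \<open>p\<close> along
  \<open>k\<close> would come strictly closer.\<close>

lemma projection_onto_closed_subspace:
  fixes K :: "'a::{real_inner,complete_space} set"
  assumes K: "subspace K" "closed K"
  obtains p where "p \<in> K" "\<And>k. k \<in> K \<Longrightarrow> (x - p) \<bullet> k = 0"
proof -
  define d where "d = Inf ((\<lambda>k. (norm (x - k))\<^sup>2) ` K)"
  have bdd: "bdd_below ((\<lambda>k. (norm (x - k))\<^sup>2) ` K)"
    by (rule bdd_belowI[of _ 0]) auto
  have ne: "(\<lambda>k. (norm (x - k))\<^sup>2) ` K \<noteq> {}"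
    using subspace_0[OF K(1)] by auto
  have dle: "d \<le> (norm (x - k))\<^sup>2" if "k \<in> K" for k
    unfolding d_def using bdd that by (intro cInf_lower) auto
  have "\<exists>k\<in>K. (norm (x - k))\<^sup>2 < d + 1 / real (Suc n)" for n
    using cInf_lessD[OF ne, of "d + 1 / real (Suc n)"] by (auto simp: d_def)
  then obtain k where k: "\<And>n. k n \<in> K" "\<And>n. (norm (x - k n))\<^sup>2 < d + 1 / real (Suc n)"
    by metis
  \<comment> \<open>The parallelogram law for \<open>x - a\<close> and \<open>x - b\<close>. For
    \<open>a\<close>, \<open>b\<close> in \<open>K\<close> the midpoint lies in \<open>K\<close>, so
    the subtracted term is at least 4 d.\<close>
  have par: "(norm (a - b))\<^sup>2 = 2 * (norm (x - a))\<^sup>2 + 2 * (norm (x - b))\<^sup>2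
      - 4 * (norm (x - (1/2) *\<^sub>R (a + b)))\<^sup>2" for a b
    unfolding power2_norm_eq_inner
    by (simp add: inner_diff_left inner_diff_right inner_add_left inner_add_right inner_commute
        algebra_simps)
  have close: "(norm (k m - k n))\<^sup>2 \<le> 4 / real (Suc N)" if "m \<ge> N" "n \<ge> N" for m n N
  proof -
    have "1 / real (Suc m) \<le> 1 / real (Suc N)" "1 / real (Suc n) \<le> 1 / real (Suc N)"
      using that by (auto simp: frac_le)
    moreover have "d \<le> (norm (x - (1/2) *\<^sub>R (k m + k n)))\<^sup>2"
      using k(1) K(1) by (intro dle) (auto intro: subspace_add subspace_scale)
    ultimately show ?thesis
      using k(2)[of m] k(2)[of n] unfolding par[of "k m" "k n"] by simp
  qed
  have "Cauchy k"
  proof (rule metric_CauchyI)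
    fix e :: real assume "0 < e"
    obtain N where "4 / e\<^sup>2 < real N" using reals_Archimedean2 by blast
    then have N: "4 / real (Suc N) < e\<^sup>2"
      using \<open>0 < e\<close> by (simp add: field_simps add_pos_pos less_add_same_cancel2 add_strict_increasing)
    show "\<exists>M. \<forall>m\<ge>M. \<forall>n\<ge>M. dist (k m) (k n) < e"
      using close N \<open>0 < e\<close>
      by (intro exI[of _ N] allI impI) (smt (verit) dist_norm power2_less_imp_less)
  qed
  then obtain p where p: "k \<longlonglongrightarrow> p"
    using Cauchy_convergent_iff convergent_def by blast
  have pK: "p \<in> K"
    using K(2) k(1) p by (meson closed_sequentially)
  have "(\<lambda>n. (norm (x - k n))\<^sup>2) \<longlonglongrightarrow> (norm (x - p))\<^sup>2"
    by (intro tendsto_intros p)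
  moreover have "(\<lambda>n. d + 1 / real (Suc n)) \<longlonglongrightarrow> d + 0"
    by (intro tendsto_add tendsto_const LIMSEQ_Suc[OF lim_1_over_n])
  ultimately have pd: "(norm (x - p))\<^sup>2 \<le> d"
    using k(2) by (intro LIMSEQ_le[of _ "(norm (x - p))\<^sup>2" _ d]) (auto intro: less_imp_le)
  have "(x - p) \<bullet> k = 0" if "k \<in> K" for k
  proof (rule ccontr)
    assume c: "(x - p) \<bullet> k \<noteq> 0"
    \<comment> \<open>This \<open>t\<close> minimizes the quadratic polynomial s \<mapsto> |x - p -
      s k|^2.\<close>
    define t where "t = ((x - p) \<bullet> k) / (k \<bullet> k)"
    have kk: "k \<bullet> k > 0" using c by auto
    have "p + t *\<^sub>R k \<in> K" using pK that K(1) by (auto intro: subspace_add subspace_scale)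
    have "(norm (x - p))\<^sup>2 \<le> (norm (x - (p + t *\<^sub>R k)))\<^sup>2"
      by (rule order_trans[OF pd dle]) fact
    also have "\<dots> = (norm (x - p))\<^sup>2 - 2 * t * ((x - p) \<bullet> k) + t\<^sup>2 * (k \<bullet> k)"
      unfolding power2_norm_eq_inner
      by (simp add: inner_diff_left inner_diff_right inner_add_left inner_add_right inner_commute
        algebra_simps power2_eq_square)
    also have "\<dots> = (norm (x - p))\<^sup>2 - ((x - p) \<bullet> k)\<^sup>2 / (k \<bullet> k)"
      using kk by (simp add: t_def field_simps power2_eq_square)
    finally show False using kk c by (simp add: divide_le_0_iff)
  qed
  with pK show ?thesis by (rule that)
qed

text \<open>The abstract form of M. Here \<open>U\<close> stands for the L2 forms of degree l - 1
  and \<open>K\<close> for the set of all pairs (d*v, dv) with v in H10. The condition on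
  \<open>h\<close> in the inner quantifier then says that dh = 0 in the dual space.\<close>

definition annihilator_complement ::
  "'a::real_inner set \<Rightarrow> ('a \<times> 'b) set \<Rightarrow> 'a set" where
  "annihilator_complement U K = {q \<in> U. \<forall>h\<in>U. (\<forall>k\<in>K. h \<bullet> fst k = 0) \<longrightarrow> q \<bullet> h = 0}"

definition ba_bound :: "'a::real_inner set \<Rightarrow> ('a \<times> 'b::real_inner) set \<Rightarrow> real \<Rightarrow> bool" where
  "ba_bound U K C \<longleftrightarrow>
    (\<forall>q\<in>annihilator_complement U K. \<exists>k\<in>K. fst k = q \<and> (norm k)\<^sup>2 \<le> C * (norm q)\<^sup>2)"

text \<open>With \<open>k\<close> = (d*v, dv), the premise is the equation dh = d*g tested against
  v. \<open>W\<close> stands for the L2 forms of degree l + 1.\<close>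

definition fv_bound ::
  "'a::real_inner set \<Rightarrow> 'b::real_inner set \<Rightarrow> ('a \<times> 'b) set \<Rightarrow> real \<Rightarrow> bool" where
  "fv_bound U W K \<Gamma> \<longleftrightarrow>
    (\<forall>h\<in>annihilator_complement U K. \<forall>g\<in>W.
       (\<forall>k\<in>K. h \<bullet> fst k = g \<bullet> snd k) \<longrightarrow> (norm h)\<^sup>2 \<le> \<Gamma> * (norm g)\<^sup>2)"

lemma norm_prod_squared: "(norm k)\<^sup>2 = (norm (fst k))\<^sup>2 + (norm (snd k))\<^sup>2"
  by (cases k) (simp add: norm_Pair)

lemma ba_bound_imp_fv_bound:
  assumes ba: "ba_bound U K C" and q: "q \<in> annihilator_complement U K" "q \<noteq> 0"
  shows "fv_bound U W K (C - 1)"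
  unfolding fv_bound_def
proof (intro ballI impI)
  \<comment> \<open>Since |k| is at least |fst k|, one nonzero \<open>q\<close> forces this. It
    keeps the right-hand side nonnegative in the case \<open>h = 0\<close> below.\<close>
  have C: "C \<ge> 1"
  proof -
    obtain k where "k \<in> K" "fst k = q" "(norm k)\<^sup>2 \<le> C * (norm q)\<^sup>2"
      using ba q(1) unfolding ba_bound_def by blast
    then have "1 * (norm q)\<^sup>2 \<le> C * (norm q)\<^sup>2"
      using norm_prod_squared[of k] by (smt (verit) zero_le_power2)
    then show ?thesis using q(2) by (simp add: mult_le_cancel_right)
  qed
  fix h g assume h: "h \<in> annihilator_complement U K" and g: "g \<in> W"
    and eq: "\<forall>k\<in>K. h \<bullet> fst k = g \<bullet> snd k"
  obtain k where k: "k \<in> K" "fst k = h" "(norm k)\<^sup>2 \<le> C * (norm h)\<^sup>2"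
    using ba h unfolding ba_bound_def by blast
  have s: "(norm (snd k))\<^sup>2 \<le> (C - 1) * (norm h)\<^sup>2"
    using k norm_prod_squared[of k] by (simp add: algebra_simps)
  show "(norm h)\<^sup>2 \<le> (C - 1) * (norm g)\<^sup>2"
  proof (cases "h = 0")
    case True
    then show ?thesis using C by simp
  next
    case False
    have "(norm h)\<^sup>2 = g \<bullet> snd k"
      using eq k by (metis power2_norm_eq_inner)
    also have "\<dots> \<le> norm g * norm (snd k)" by (rule norm_cauchy_schwarz)
    finally have "((norm h)\<^sup>2)\<^sup>2 \<le> (norm g)\<^sup>2 * (norm (snd k))\<^sup>2"
      by (metis power_mono power_mult_distrib zero_le_power2)
    also have "\<dots> \<le> (norm g)\<^sup>2 * ((C - 1) * (norm h)\<^sup>2)"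
      using s by (intro mult_left_mono) auto
    finally have "(norm h)\<^sup>2 * (norm h)\<^sup>2 \<le> ((C - 1) * (norm g)\<^sup>2) * (norm h)\<^sup>2"
      by (simp add: power2_eq_square mult_ac)
    then show ?thesis
      by (rule mult_right_le_imp_le) (use False in simp)
  qed
qed

text \<open>With S h = \<open>fst (w h)\<close>, the equation S h = q is the fixed point equation of
  \<open>f h = h - S h + q\<close>. On the complete set M this map is a contraction with ratio
  \<Gamma> / (1 + \<Gamma>), so Banach's theorem solves it, and \<open>w h\<close> is the element
  sought.\<close>

lemma fv_bound_imp_ba_bound:
  fixes K :: "('a::{real_inner,complete_space} \<times> 'b::{real_inner,complete_space}) set"
  assumes fv: "fv_bound U W K \<Gamma>" and \<Gamma>: "0 \<le> \<Gamma>"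
    and U: "subspace U" "closed U" and K: "subspace K" "closed K"
    and KU: "fst ` K \<subseteq> U" and KW: "snd ` K \<subseteq> W"
  shows "ba_bound U K (\<Gamma> + 1)"
  unfolding ba_bound_def
proof
  let ?M = "annihilator_complement U K"
  have M: "subspace ?M"
    using U(1) unfolding annihilator_complement_def subspace_def by (auto simp: inner_add_left)
  have "?M = U \<inter> (\<Inter>h\<in>{h\<in>U. \<forall>k\<in>K. h \<bullet> fst k = 0}. {q. q \<bullet> h = 0})"
    by (auto simp: annihilator_complement_def)
  then have "closed ?M"
    using U(2) by (auto intro!: closed_Int closed_INT closed_Collect_eq continuous_intros)
  then have cM: "complete ?M" by (simp add: complete_eq_closed)
  \<comment> \<open>This is the inclusion of the range of d* in M.\<close>
  have KM: "fst k \<in> ?M" if "k \<in> K" for k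
    using KU that by (auto simp: annihilator_complement_def inner_commute)
  have "\<exists>w\<in>K. \<forall>k\<in>K. ((h, 0) - w) \<bullet> k = 0" for h :: 'a
    using projection_onto_closed_subspace[OF K, of "(h, 0)"] by metis
  then obtain w where wK: "\<And>h. w h \<in> K" and wo: "\<And>h k. k \<in> K \<Longrightarrow> ((h, 0) - w h) \<bullet> k = 0"
    by metis
  text \<open>If \<open>v\<close> is the projection of \<open>(h, 0)\<close> onto \<open>K\<close>, the pair \<open>(h - fst v, snd v)\<close> satisfies the
    premise of the Friedrichs--Velte inequality.\<close>
  have key: "(1 + \<Gamma>) * norm (h - fst v) \<le> \<Gamma> * norm h"
    if h: "h \<in> ?M" and v: "v \<in> K" and o: "\<And>k. k \<in> K \<Longrightarrow> ((h, 0) - v) \<bullet> k = 0" for h v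
  proof -
    have o': "(h - fst v) \<bullet> fst k = snd v \<bullet> snd k" if "k \<in> K" for k
      using o[OF that] by (simp add: inner_prod_def)
    have "h - fst v \<in> ?M" using M h KM[OF v] by (intro subspace_diff)
    then have 1: "(norm (h - fst v))\<^sup>2 \<le> \<Gamma> * (norm (snd v))\<^sup>2"
      using fv v KW o' unfolding fv_bound_def by blast
    \<comment> \<open>Orthogonality tested with \<open>v\<close> itself gives |snd v|^2 = (h - fst
      v) \<bullet> fst v, and fst v = h - (h - fst v).\<close>
    have "(norm (snd v))\<^sup>2 = (h - fst v) \<bullet> h - (norm (h - fst v))\<^sup>2"
      unfolding power2_norm_eq_inner using o'[OF v] by (simp add: inner_diff_right)
    also have "\<dots> \<le> norm (h - fst v) * norm h - (norm (h - fst v))\<^sup>2"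
      using norm_cauchy_schwarz by auto
    finally have "(norm (h - fst v))\<^sup>2 \<le> \<Gamma> * (norm (h - fst v) * norm h - (norm (h - fst v))\<^sup>2)"
      using 1 \<Gamma> by (meson mult_left_mono order_trans)
    then have "norm (h - fst v) * ((1 + \<Gamma>) * norm (h - fst v)) \<le> norm (h - fst v) * (\<Gamma> * norm h)"
      by (simp add: algebra_simps power2_eq_square)
    then show ?thesis using \<Gamma>
      by (cases "h = fst v") (auto simp: mult_le_cancel_left)
  qed
  fix q assume q: "q \<in> ?M"
  define f where "f h = h - fst (w h) + q" for h
  have "\<exists>!h\<in>?M. f h = h"
  proof (rule Banach_fix[OF cM _ _ _ _ ])
    show "?M \<noteq> {}" using q by auto
    show "0 \<le> \<Gamma> / (1 + \<Gamma>)" "\<Gamma> / (1 + \<Gamma>) < 1" using \<Gamma> by auto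
    show "f ` ?M \<subseteq> ?M"
      using M q KM[OF wK] unfolding f_def by (auto intro!: subspace_add subspace_diff)
    fix x y assume xy: "x \<in> ?M" "y \<in> ?M"
    \<comment> \<open>\<open>key\<close> asks only for an element of \<open>K\<close> with
      orthogonal residual, so it applies to \<open>w x - w y\<close> and linearity of
      \<open>w\<close> need not be established.\<close>
    have "(1 + \<Gamma>) * norm ((x - y) - fst (w x - w y)) \<le> \<Gamma> * norm (x - y)"
    proof (rule key)
      show "((x - y, 0) - (w x - w y)) \<bullet> k = 0" if "k \<in> K" for k
        using wo[OF that, of x] wo[OF that, of y]
        by (simp add: inner_prod_def inner_diff_left)
    qed (use xy M wK K(1) in \<open>auto intro: subspace_diff\<close>)
    then show "dist (f x) (f y) \<le> \<Gamma> / (1 + \<Gamma>) * dist x y"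
      using \<Gamma> by (simp add: f_def dist_norm field_simps)
  qed
  then obtain h where h: "h \<in> ?M" "fst (w h) = q" by (auto simp: f_def)
  \<comment> \<open>Here h - q = h - S h, so \<open>key\<close> bounds (1 + \<Gamma>) |h - q| by
    \<Gamma> |h|, and \<Gamma> |h| cancels from both sides.\<close>
  have "norm h \<le> norm (h - q) + norm q"
    using norm_triangle_sub[of h q] by simp
  then have "(1 + \<Gamma>) * norm h \<le> (1 + \<Gamma>) * norm (h - q) + (1 + \<Gamma>) * norm q"
    using \<Gamma> by (metis distrib_left mult_left_mono add_nonneg_nonneg zero_le_one)
  with key[OF h(1) wK wo] have hq: "norm h \<le> (1 + \<Gamma>) * norm q"
    unfolding h(2) by (simp add: algebra_simps)
  \<comment> \<open>The residual \<open>(h, 0) - w h\<close> is orthogonal to \<open>w h\<close>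
    itself.\<close>
  have "(norm (w h))\<^sup>2 = h \<bullet> q"
    using wo[OF wK, of h h] unfolding power2_norm_eq_inner
    by (simp add: inner_prod_def inner_diff_left h(2))
  also have "\<dots> \<le> norm h * norm q" by (rule norm_cauchy_schwarz)
  also have "\<dots> \<le> (1 + \<Gamma>) * norm q * norm q" using hq by (intro mult_right_mono) auto
  finally show "\<exists>k\<in>K. fst k = q \<and> (norm k)\<^sup>2 \<le> (\<Gamma> + 1) * (norm q)\<^sup>2"
    using wK h(2) by (intro bexI[of _ "w h"]) (auto simp: power2_eq_square algebra_simps)
qed


section \<open>The Hilbert space of square integrable functions\<close>

definition square_integrable ::
  "'a measure \<Rightarrow> ('a \<Rightarrow> 'b::euclidean_space) \<Rightarrow> bool" where
  "square_integrable M f \<longleftrightarrow> f \<in> borel_measurable M \<and> integrable M (\<lambda>x. (norm (f x))\<^sup>2)"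

lemma square_integrableD:
  assumes "square_integrable M f"
  shows "f \<in> borel_measurable M" "integrable M (\<lambda>x. (norm (f x))\<^sup>2)"
  using assms by (auto simp: square_integrable_def)

lemma square_integrable_zero [simp]: "square_integrable M (\<lambda>x. 0)"
  by (simp add: square_integrable_def)

lemma square_integrable_bound:
  assumes "square_integrable M f" "g \<in> borel_measurable M" "AE x in M. norm (g x) \<le> norm (f x)"
  shows "square_integrable M g"
  unfolding square_integrable_def
proof
  show "integrable M (\<lambda>x. (norm (g x))\<^sup>2)"
    by (rule Bochner_Integration.integrable_bound[OF square_integrableD(2)[OF assms(1)]])
      (use assms(2,3) in \<open>auto intro: power_mono\<close>)
qed (fact assms)

lemma square_integrable_add:
  assumes "square_integrable M f" "square_integrable M g"
  shows "square_integrable M (\<lambda>x. f x + g x)"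
proof -
  note [measurable] = square_integrableD(1)[OF assms(1)] square_integrableD(1)[OF assms(2)]
  have *: "(norm (f x + g x))\<^sup>2 \<le> 2 * (norm (f x))\<^sup>2 + 2 * (norm (g x))\<^sup>2" for x
  proof -
    have "(norm (f x + g x))\<^sup>2 \<le> (norm (f x) + norm (g x))\<^sup>2"
      by (intro power_mono norm_triangle_ineq) auto
    then show ?thesis
      using sum_squares_bound[of "norm (f x)" "norm (g x)"] by (simp add: power2_sum)
  qed
  have "integrable M (\<lambda>x. (norm (f x + g x))\<^sup>2)"
    by (rule Bochner_Integration.integrable_bound[where f="\<lambda>x. 2 * (norm (f x))\<^sup>2 + 2 * (norm (g x))\<^sup>2"])
      (use assms * in \<open>auto intro!: square_integrableD(2)\<close>)
  then show ?thesis by (simp add: square_integrable_def)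
qed

lemma square_integrable_scaleR:
  "square_integrable M f \<Longrightarrow> square_integrable M (\<lambda>x. c *\<^sub>R f x)"
  by (auto simp: square_integrable_def power_mult_distrib)

lemma square_integrable_diff:
  assumes "square_integrable M f" "square_integrable M g"
  shows "square_integrable M (\<lambda>x. f x - g x)"
  using square_integrable_add[OF assms(1) square_integrable_scaleR[OF assms(2), of "-1"]] by simp

lemma square_integrable_inner:
  assumes "square_integrable M f" "square_integrable M g"
  shows "integrable M (\<lambda>x. f x \<bullet> g x)"
proof (rule Bochner_Integration.integrable_bound[where f="\<lambda>x. (norm (f x))\<^sup>2 + (norm (g x))\<^sup>2"])
  have "norm (f x \<bullet> g x) \<le> norm ((norm (f x))\<^sup>2 + (norm (g x))\<^sup>2)" for x
  proof -
    have "norm (f x \<bullet> g x) \<le> norm (f x) * norm (g x)"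
      using Cauchy_Schwarz_ineq2 by simp
    also have "\<dots> \<le> (norm (f x))\<^sup>2 + (norm (g x))\<^sup>2"
      using sum_squares_bound[of "norm (f x)" "norm (g x)"]
        mult_nonneg_nonneg[OF norm_ge_zero[of "f x"] norm_ge_zero[of "g x"]]
      by linarith
    finally show ?thesis by simp
  qed
  then show "AE x in M. norm (f x \<bullet> g x) \<le> norm ((norm (f x))\<^sup>2 + (norm (g x))\<^sup>2)" by simp
  show "integrable M (\<lambda>x. (norm (f x))\<^sup>2 + (norm (g x))\<^sup>2)"
    using square_integrableD(2)[OF assms(1)] square_integrableD(2)[OF assms(2)] by simp
  show "(\<lambda>x. f x \<bullet> g x) \<in> borel_measurable M"
    using square_integrableD(1)[OF assms(1)] square_integrableD(1)[OF assms(2)]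
    by (rule borel_measurable_inner)
qed

text \<open>With \<open>H = (\<Sum>n. 4\<^sup>n |f\<^sub>n\<^sub>+\<^sub>1 - f\<^sub>n|\<^sup>2)\<close>, which has finite integral, \<open>|f\<^sub>n\<^sub>+\<^sub>1 - f\<^sub>n| \<le> 2\<^sup>-\<^sup>n \<surd>H\<close>; so
  \<open>f\<^sub>n\<close> converges almost everywhere and \<open>|g - f\<^sub>m|\<^sup>2 \<le> 4\<cdot>4\<^sup>-\<^sup>m H\<close> for the limit \<open>g\<close>.\<close>

lemma fast_Cauchy_square_integrable:
  fixes f :: "nat \<Rightarrow> 'a \<Rightarrow> 'b::euclidean_space"
  assumes f: "\<And>n. square_integrable M (f n)"
    and fast: "\<And>n. (\<integral>x. (norm (f (Suc n) x - f n x))\<^sup>2 \<partial>M) \<le> (1/8) ^ n"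
  obtains g where "square_integrable M g"
    "(\<lambda>n. \<integral>x. (norm (g x - f n x))\<^sup>2 \<partial>M) \<longlonglongrightarrow> 0"
proof -
  have fm [measurable]: "f n \<in> borel_measurable M" for n
    using f square_integrableD by blast
  define D where "D n x = (norm (f (Suc n) x - f n x))\<^sup>2" for n x
  have D: "integrable M (D n)" "D n x \<ge> 0" for n x
    unfolding D_def using square_integrableD(2)[OF square_integrable_diff[OF f f]] by auto
  have Dm [measurable]: "D n \<in> borel_measurable M" for n using D(1) by auto
  \<comment> \<open>Taken in the extended nonnegative reals, so that sum and integral may be
    interchanged before anything is known to be finite. The weights 4^n leave the terms 4^n / 8^n =
    2^-n.\<close>
  define H where "H x = (\<Sum>n. ennreal (4 ^ n * D n x))" for x
  have Hm [measurable]: "H \<in> borel_measurable M" unfolding H_def by measurable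
  have "(\<integral>\<^sup>+x. H x \<partial>M) = (\<Sum>n. \<integral>\<^sup>+x. ennreal (4 ^ n * D n x) \<partial>M)"
    unfolding H_def by (intro nn_integral_suminf) simp
  also have "\<dots> = (\<Sum>n. ennreal (4 ^ n * (\<integral>x. D n x \<partial>M)))"
  proof (rule arg_cong[where f=suminf], rule ext)
    fix n
    show "(\<integral>\<^sup>+x. ennreal (4 ^ n * D n x) \<partial>M) = ennreal (4 ^ n * (\<integral>x. D n x \<partial>M))"
      using D by (subst nn_integral_eq_integral) auto
  qed
  also have "\<dots> \<le> (\<Sum>n. ennreal ((1/2) ^ n))"
  proof (intro suminf_le ennreal_leI)
    fix n
    have "4 ^ n * (\<integral>x. D n x \<partial>M) \<le> 4 ^ n * (1/8) ^ n"
      using fast by (intro mult_left_mono) (auto simp: D_def)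
    also have "\<dots> = (1/2) ^ n" by (simp flip: power_mult_distrib)
    finally show "4 ^ n * (\<integral>x. D n x \<partial>M) \<le> (1/2) ^ n" .
  qed auto
  also have "\<dots> = ennreal (\<Sum>n. (1/2) ^ n)"
    by (intro suminf_ennreal2) (auto intro: summable_geometric)
  finally have Hfin: "(\<integral>\<^sup>+x. H x \<partial>M) < \<infinity>"
    using le_less_trans by (metis ennreal_less_top infinity_ennreal_def)
  define h where "h x = enn2real (H x)" for x
  have hm [measurable]: "h \<in> borel_measurable M" unfolding h_def by measurable
  have AEH: "AE x in M. H x \<noteq> \<infinity>"
    using Hfin by (intro nn_integral_noteq_infinite) auto
  have "(\<integral>\<^sup>+x. ennreal (norm (h x)) \<partial>M) = (\<integral>\<^sup>+x. H x \<partial>M)"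
    using AEH by (intro nn_integral_cong_AE) (auto simp: h_def less_top)
  then have h: "integrable M h"
    using Hfin by (intro integrableI_bounded) auto
  have step: "norm (f (Suc n) x - f n x) \<le> sqrt (h x) * (1/2) ^ n" if "H x \<noteq> \<infinity>" for n x
  proof -
    have "ennreal (4 ^ n * D n x) \<le> H x"
      unfolding H_def
      using sum_le_suminf[of "\<lambda>n. ennreal (4 ^ n * D n x)" "{n}"] by simp
    also have "\<dots> = ennreal (h x)" using that by (simp add: h_def less_top)
    finally have "4 ^ n * D n x \<le> h x"
      by (subst (asm) ennreal_le_iff) (auto simp: h_def)
    then have "sqrt (4 ^ n * D n x) \<le> sqrt (h x)" by simp
    also have "sqrt (4 ^ n * D n x) = 2 ^ n * norm (f (Suc n) x - f n x)"
      using real_sqrt_abs2[of "2::real"]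
      by (simp add: D_def real_sqrt_mult real_sqrt_power)
    finally show ?thesis by (simp add: field_simps)
  qed
  \<comment> \<open>Where the sequence diverges \<open>lim\<close> is an unspecified value.
    Divergence can occur only where \<open>H\<close> is infinite, a null set by
    \<open>AEH\<close>.\<close>
  define g where "g x = lim (\<lambda>n. f n x)" for x
  have gm [measurable]: "g \<in> borel_measurable M" unfolding g_def by measurable
  have bound: "norm (g x - f m x) \<le> 2 * sqrt (h x) * (1/2) ^ m" if x: "H x \<noteq> \<infinity>" for m x
  proof -
    have sg: "summable (\<lambda>n. sqrt (h x) * (1/2) ^ (n + m))"
      by (auto simp: power_add intro!: summable_mult summable_mult2 summable_geometric)
    have sm: "summable (\<lambda>n. norm (f (Suc (n + m)) x - f (n + m) x))"
      using step[OF x] by (intro summable_comparison_test'[OF sg]) auto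
    then have sm': "summable (\<lambda>n. f (Suc (n + m)) x - f (n + m) x)"
      by (rule summable_norm_cancel)
    have "(\<lambda>n. \<Sum>i<n. f (Suc (i + m)) x - f (i + m) x) \<longlonglongrightarrow> (\<Sum>n. f (Suc (n + m)) x - f (n + m) x)"
      using sm' by (rule summable_LIMSEQ)
    moreover have "(\<Sum>i<n. f (Suc (i + m)) x - f (i + m) x) = f (n + m) x - f m x" for n
      using sum_lessThan_telescope[of "\<lambda>i. f (i + m) x" n] by simp
    ultimately have "(\<lambda>n. f (n + m) x - f m x + f m x) \<longlonglongrightarrow>
        (\<Sum>n. f (Suc (n + m)) x - f (n + m) x) + f m x"
      by (intro tendsto_add) auto
    then have "(\<lambda>n. f n x) \<longlonglongrightarrow> (\<Sum>n. f (Suc (n + m)) x - f (n + m) x) + f m x"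
      by (simp add: LIMSEQ_offset)
    then have "g x - f m x = (\<Sum>n. f (Suc (n + m)) x - f (n + m) x)"
      unfolding g_def by (simp add: limI)
    also have "norm \<dots> \<le> (\<Sum>n. norm (f (Suc (n + m)) x - f (n + m) x))"
      by (rule summable_norm[OF sm])
    also have "\<dots> \<le> (\<Sum>n. sqrt (h x) * (1/2) ^ (n + m))"
      using step[OF x] sm sg by (intro suminf_le) auto
    also have "\<dots> = (\<Sum>n. (sqrt (h x) * (1/2) ^ m) * (1/2) ^ n)"
      by (simp add: power_add mult_ac)
    also have "\<dots> = (sqrt (h x) * (1/2) ^ m) * (\<Sum>n. (1/2) ^ n)"
      by (intro suminf_mult summable_geometric) auto
    also have "\<dots> = 2 * sqrt (h x) * (1/2) ^ m"
      by (simp add: suminf_geometric)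
    finally show ?thesis .
  qed
  have h0: "h x \<ge> 0" for x by (simp add: h_def)
  have bound2: "(norm (g x - f m x))\<^sup>2 \<le> 4 * (1/4) ^ m * h x" if x: "H x \<noteq> \<infinity>" for m x
  proof -
    have "(norm (g x - f m x))\<^sup>2 \<le> (2 * sqrt (h x) * (1/2) ^ m)\<^sup>2"
      using bound[OF x] by (intro power_mono) auto
    also have "\<dots> = 4 * ((1/2)^2) ^ m * h x"
      using h0[of x] by (simp add: power_mult_distrib flip: power_mult) (simp add: mult.commute)
    finally show ?thesis by (simp add: power2_eq_square)
  qed
  \<comment> \<open>The square of the difference is dominated by a multiple of the integrable
    \<open>h\<close>. Square integrability of \<open>g\<close> follows on adding \<open>f 0\<close>,
    and convergence follows from the factor (1/4)^m.\<close>
  have gf: "square_integrable M (\<lambda>x. g x - f m x)" for m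
    unfolding square_integrable_def
  proof
    show "integrable M (\<lambda>x. (norm (g x - f m x))\<^sup>2)"
    proof (rule Bochner_Integration.integrable_bound)
      show "integrable M (\<lambda>x. 4 * (1/4) ^ m * h x)" using h by simp
      show "AE x in M. norm ((norm (g x - f m x))\<^sup>2) \<le> norm (4 * (1/4) ^ m * h x)"
        using AEH by eventually_elim (use bound2 h0 in auto)
    qed simp
  qed simp
  show thesis
  proof
    show "square_integrable M g"
      using square_integrable_add[OF gf f, of 0 0] by simp
    show "(\<lambda>n. \<integral>x. (norm (g x - f n x))\<^sup>2 \<partial>M) \<longlonglongrightarrow> 0"
    proof (rule tendsto_sandwich[of "\<lambda>_. 0"])
      show "\<forall>\<^sub>F n in sequentially. (\<integral>x. (norm (g x - f n x))\<^sup>2 \<partial>M) \<le> 4 * (1/4) ^ n * (\<integral>x. h x \<partial>M)"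
      proof (rule always_eventually, rule allI)
        fix n
        have "(\<integral>x. (norm (g x - f n x))\<^sup>2 \<partial>M) \<le> (\<integral>x. 4 * (1/4) ^ n * h x \<partial>M)"
          using AEH h square_integrableD(2)[OF gf]
          by (intro integral_mono_AE) (auto elim!: eventually_mono intro: bound2)
        then show "(\<integral>x. (norm (g x - f n x))\<^sup>2 \<partial>M) \<le> 4 * (1/4) ^ n * (\<integral>x. h x \<partial>M)" by simp
      qed
      have "(\<lambda>n. (1/4::real) ^ n) \<longlonglongrightarrow> 0" by (rule LIMSEQ_power_zero) simp
      then show "(\<lambda>n. 4 * (1/4) ^ n * (\<integral>x. h x \<partial>M)) \<longlonglongrightarrow> 0"
        by (intro tendsto_mult_left_zero tendsto_mult_right_zero)
      show "\<forall>\<^sub>F n in sequentially. 0 \<le> (\<integral>x. (norm (g x - f n x))\<^sup>2 \<partial>M)"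
        by (rule always_eventually) simp
    qed simp
  qed
qed

text \<open>A partial equivalence relation whose domain consists of the square integrable functions,
  so the quotient contains only their classes. All functions live on the whole space: a type cannot
  depend on \<Omega>, and forms on \<Omega> enter through extension by zero.\<close>

definition lsq_rel ::
  "('a::euclidean_space \<Rightarrow> 'b::euclidean_space) \<Rightarrow> ('a \<Rightarrow> 'b) \<Rightarrow> bool" where
  "lsq_rel f g \<longleftrightarrow> square_integrable lebesgue f \<and> square_integrable lebesgue g \<and>
     (AE x in lebesgue. f x = g x)"

quotient_type (overloaded) ('a, 'b) lsq =
  "'a::euclidean_space \<Rightarrow> 'b::euclidean_space" / partial: lsq_rel
proof (rule part_equivpI)
  show "\<exists>f. lsq_rel f f" by (rule exI[of _ "\<lambda>x. 0"]) (simp add: lsq_rel_def)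
  show "symp lsq_rel" by (rule sympI) (auto simp: lsq_rel_def)
  show "transp lsq_rel" by (rule transpI) (auto simp: lsq_rel_def elim: eventually_elim2)
qed

section \<open>The inner product space of square integrable functions modulo null sets\<close>

instantiation lsq :: (euclidean_space, euclidean_space) real_vector
begin

lift_definition zero_lsq :: "('a, 'b) lsq" is "\<lambda>x. 0"
  by (simp add: lsq_rel_def)

lift_definition plus_lsq :: "('a, 'b) lsq \<Rightarrow> ('a, 'b) lsq \<Rightarrow> ('a, 'b) lsq" is
  "\<lambda>f g x. f x + g x"
  by (auto simp: lsq_rel_def square_integrable_add elim: eventually_elim2)

lift_definition minus_lsq :: "('a, 'b) lsq \<Rightarrow> ('a, 'b) lsq \<Rightarrow> ('a, 'b) lsq" is
  "\<lambda>f g x. f x - g x"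
  by (auto simp: lsq_rel_def square_integrable_diff elim: eventually_elim2)

lift_definition scaleR_lsq :: "real \<Rightarrow> ('a, 'b) lsq \<Rightarrow> ('a, 'b) lsq" is
  "\<lambda>c f x. c *\<^sub>R f x"
  by (auto simp: lsq_rel_def square_integrable_scaleR)

definition uminus_lsq :: "('a, 'b) lsq \<Rightarrow> ('a, 'b) lsq" where "uminus_lsq f = 0 - f"

instance
proof
  fix f g h :: "('a, 'b) lsq" and a b :: real
  show "f + g + h = f + (g + h)"
    by transfer (auto simp: lsq_rel_def square_integrable_add add.assoc)
  show "f + g = g + f"
    by transfer (auto simp: lsq_rel_def square_integrable_add add.commute)
  show "0 + f = f"
    by transfer (auto simp: lsq_rel_def)
  show "- f + f = 0"
    unfolding uminus_lsq_def
    by transfer (auto simp: lsq_rel_def square_integrable_add square_integrable_diff)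
  show "f - g = f + - g"
    unfolding uminus_lsq_def
    by transfer (auto simp: lsq_rel_def square_integrable_add square_integrable_diff)
  show "a *\<^sub>R (f + g) = a *\<^sub>R f + a *\<^sub>R g"
    by transfer (auto simp: lsq_rel_def square_integrable_add square_integrable_scaleR algebra_simps)
  show "(a + b) *\<^sub>R f = a *\<^sub>R f + b *\<^sub>R f"
    by transfer (auto simp: lsq_rel_def square_integrable_add square_integrable_scaleR algebra_simps)
  show "a *\<^sub>R b *\<^sub>R f = (a * b) *\<^sub>R f"
    by transfer (auto simp: lsq_rel_def square_integrable_scaleR)
  show "1 *\<^sub>R f = f"
    by transfer (auto simp: lsq_rel_def)
qed

end

instantiation lsq :: (euclidean_space, euclidean_space) real_inner
begin

lift_definition inner_lsq :: "('a, 'b) lsq \<Rightarrow> ('a, 'b) lsq \<Rightarrow> real" is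
  "\<lambda>f g. \<integral>x. f x \<bullet> g x \<partial>lebesgue"
proof -
  fix f f' g g' :: "'a \<Rightarrow> 'b"
  assume a: "lsq_rel f f'" "lsq_rel g g'"
  show "(\<integral>x. f x \<bullet> g x \<partial>lebesgue) = (\<integral>x. f' x \<bullet> g' x \<partial>lebesgue)"
    using a square_integrable_inner unfolding lsq_rel_def
    by (intro integral_cong_AE) (auto elim: eventually_elim2 intro!: borel_measurable_integrable)
qed

definition norm_lsq :: "('a, 'b) lsq \<Rightarrow> real" where "norm_lsq f = sqrt (f \<bullet> f)"
definition dist_lsq :: "('a, 'b) lsq \<Rightarrow> ('a, 'b) lsq \<Rightarrow> real" where "dist_lsq f g = norm (f - g)"
definition sgn_lsq :: "('a, 'b) lsq \<Rightarrow> ('a, 'b) lsq" where "sgn_lsq f = f /\<^sub>R norm f"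
definition uniformity_lsq :: "(('a, 'b) lsq \<times> ('a, 'b) lsq) filter" where
  "uniformity_lsq = (INF e\<in>{0<..}. principal {(x, y). dist x y < e})"
definition open_lsq :: "('a, 'b) lsq set \<Rightarrow> bool" where
  "open_lsq S = (\<forall>x\<in>S. \<forall>\<^sub>F (x', y) in uniformity. x' = x \<longrightarrow> y \<in> S)"

instance
proof
  fix f g h :: "('a, 'b) lsq" and a :: real
  show "f \<bullet> g = g \<bullet> f"
    by transfer (simp add: inner_commute)
  show "(f + g) \<bullet> h = f \<bullet> h + g \<bullet> h"
    by transfer (simp add: lsq_rel_def inner_add_left square_integrable_inner)
  show "(a *\<^sub>R f) \<bullet> g = a * (f \<bullet> g)"
    by transfer simp
  show "0 \<le> f \<bullet> f"
    by transfer simp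
  show "(f \<bullet> f = 0) = (f = 0)"
    by transfer (auto simp: lsq_rel_def integral_nonneg_eq_0_iff_AE square_integrable_inner)
  show "norm f = sqrt (f \<bullet> f)" by (rule norm_lsq_def)
  show "dist f g = norm (f - g)" by (rule dist_lsq_def)
  show "sgn f = f /\<^sub>R norm f" by (rule sgn_lsq_def)
next
  show "uniformity = (INF e\<in>{0<..}. principal {(x, y :: ('a, 'b) lsq). dist x y < e})"
    by (rule uniformity_lsq_def)
  fix S :: "('a, 'b) lsq set"
  show "open S = (\<forall>x\<in>S. \<forall>\<^sub>F (x', y) in uniformity. x' = x \<longrightarrow> y \<in> S)"
    by (rule open_lsq_def)
qed

end

lemma abs_lsq_eq_iff:
  assumes "square_integrable lebesgue f" "square_integrable lebesgue g"
  shows "abs_lsq f = abs_lsq g \<longleftrightarrow> (AE x in lebesgue. f x = g x)"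
  using assms Quotient3_rel[OF Quotient3_lsq, of f g] by (auto simp: lsq_rel_def)

lemma abs_lsq_cases:
  obtains g where "square_integrable lebesgue g" "f = abs_lsq g"
  by (metis Quotient3_abs_rep Quotient3_lsq Quotient3_rep_reflp lsq_rel_def)

lemma abs_lsq_arith:
  assumes "square_integrable lebesgue f" "square_integrable lebesgue g"
  shows "abs_lsq f + abs_lsq g = abs_lsq (\<lambda>x. f x + g x)"
    and "abs_lsq f - abs_lsq g = abs_lsq (\<lambda>x. f x - g x)"
    and "abs_lsq f \<bullet> abs_lsq g = (\<integral>x. f x \<bullet> g x \<partial>lebesgue)"
  using assms by (simp_all add: plus_lsq.abs_eq minus_lsq.abs_eq inner_lsq.abs_eq lsq_rel_def)

lemma scaleR_abs_lsq:
  "square_integrable lebesgue f \<Longrightarrow> c *\<^sub>R abs_lsq f = abs_lsq (\<lambda>x. c *\<^sub>R f x)"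
  by (simp add: scaleR_lsq.abs_eq lsq_rel_def)

lemma norm_abs_lsq:
  "square_integrable lebesgue f \<Longrightarrow> norm (abs_lsq f) = sqrt (\<integral>x. (norm (f x))\<^sup>2 \<partial>lebesgue)"
  by (simp add: norm_lsq_def abs_lsq_arith(3) power2_norm_eq_inner)

text \<open>The Riesz-Fischer theorem. A sufficiently fast subsequence converges by
  \<open>fast_Cauchy_square_integrable\<close>, and a Cauchy sequence converges to the limit of any
  convergent subsequence.\<close>

instance lsq :: (euclidean_space, euclidean_space) complete_space
proof
  fix X :: "nat \<Rightarrow> ('a, 'b) lsq"
  assume X: "Cauchy X"
  have "\<exists>N. \<forall>i\<ge>N. \<forall>j\<ge>N. dist (X i) (X j) < (1/8) ^ n" for n
    using X by (intro metric_CauchyD) auto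
  then obtain N where N: "\<And>n i j. \<lbrakk>N n \<le> i; N n \<le> j\<rbrakk> \<Longrightarrow> dist (X i) (X j) < (1/8) ^ n"
    by metis
  \<comment> \<open>Partial sums make both \<open>r n\<close> and \<open>r (Suc n)\<close> at least
    \<open>N n\<close>, so consecutive members of the subsequence are closer than (1/8)^n.\<close>
  define r where "r n = (\<Sum>k\<le>n. N k)" for n
  have r: "N n \<le> r n" "N n \<le> r (Suc n)" for n
  proof -
    have "N n \<le> sum N {..m}" if "n \<le> m" for m
      using that by (intro member_le_sum) auto
    from this[of n] this[of "Suc n"] show "N n \<le> r n" "N n \<le> r (Suc n)"
      unfolding r_def by simp_all
  qed
  have "\<exists>f. square_integrable lebesgue f \<and> X i = abs_lsq f" for i
    by (metis abs_lsq_cases)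
  then obtain F where F: "\<And>i. square_integrable lebesgue (F i)" "\<And>i. X i = abs_lsq (F i)"
    by metis
  have dF: "(\<integral>x. (norm (g x - F i x))\<^sup>2 \<partial>lebesgue) = (dist (abs_lsq g) (X i))\<^sup>2"
    if "square_integrable lebesgue g" for i g
    using that F by (simp add: dist_lsq_def abs_lsq_arith norm_abs_lsq square_integrable_diff)
  have "(\<integral>x. (norm (F (r (Suc n)) x - F (r n) x))\<^sup>2 \<partial>lebesgue) \<le> (1/8) ^ n" for n
  proof -
    let ?d = "dist (X (r (Suc n))) (X (r n))"
    have d: "?d \<le> (1/8) ^ n" using N[OF r(2) r(1)] by (rule less_imp_le)
    \<comment> \<open>The bound required below is on the squared distance, and ?d^2 is at most ?d
      because ?d is at most 1.\<close>
    then have "?d \<le> 1" by (rule order_trans) (simp add: power_le_one)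
    then have "?d * ?d \<le> 1 * ?d" by (intro mult_right_mono) auto
    with d show ?thesis
      unfolding dF[OF F(1)] F(2)[symmetric] by (simp add: power2_eq_square)
  qed
  with F(1) obtain g where g: "square_integrable lebesgue g"
    "(\<lambda>n. \<integral>x. (norm (g x - F (r n) x))\<^sup>2 \<partial>lebesgue) \<longlonglongrightarrow> 0"
    by (rule fast_Cauchy_square_integrable[of lebesgue "\<lambda>n. F (r n)"])
  then have "(\<lambda>n. sqrt ((dist (abs_lsq g) (X (r n)))\<^sup>2)) \<longlonglongrightarrow> sqrt 0"
    by (intro tendsto_real_sqrt) (simp add: dF)
  then have lim: "(\<lambda>n. dist (abs_lsq g) (X (r n))) \<longlonglongrightarrow> 0" by simp
  have "X \<longlonglongrightarrow> abs_lsq g"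
  proof (rule metric_LIMSEQ_I)
    fix e :: real assume e: "0 < e"
    have "(\<lambda>n. (1/8::real) ^ n) \<longlonglongrightarrow> 0" by (rule LIMSEQ_power_zero) simp
    then have "\<forall>\<^sub>F n in sequentially. (1/8::real) ^ n < e/2"
      using e by (intro order_tendstoD(2)) auto
    moreover have "\<forall>\<^sub>F n in sequentially. dist (abs_lsq g) (X (r n)) < e/2"
      using lim e by (intro order_tendstoD(2)) auto
    ultimately have "\<forall>\<^sub>F n in sequentially. (1/8::real) ^ n < e/2 \<and> dist (abs_lsq g) (X (r n)) < e/2"
      by eventually_elim auto
    then obtain n where n: "(1/8::real) ^ n < e/2" "dist (abs_lsq g) (X (r n)) < e/2"
      by (auto simp: eventually_sequentially)
    have "dist (X i) (abs_lsq g) < e" if "i \<ge> N n" for i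
    proof -
      have "dist (X i) (abs_lsq g) \<le> dist (X i) (X (r n)) + dist (abs_lsq g) (X (r n))"
        by (metis dist_commute dist_triangle)
      with N[OF that r(1)] n show ?thesis by linarith
    qed
    then show "\<exists>no. \<forall>i\<ge>no. dist (X i) (abs_lsq g) < e" by blast
  qed
  then show "convergent X" by (auto simp: convergent_def)
qed


section \<open>Test forms\<close>

lemma partial_eqI: "(f has_derivative f') (at x) \<Longrightarrow> partial j f x = f' (axis j 1)"
  unfolding partial_def by (metis frechet_derivative_at)

lemma partial_bounded_linear:
  assumes "bounded_linear T" "f differentiable (at x)"
  shows "partial j (\<lambda>x. T (f x)) x = T (partial j f x)"
proof -
  have "(f has_derivative frechet_derivative f (at x)) (at x)"
    using assms(2) frechet_derivative_works by blast
  from partial_eqI[OF bounded_linear.has_derivative[OF assms(1) this]]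
  show ?thesis by (simp add: partial_def)
qed

lemma partial_add:
  assumes "f differentiable (at x)" "g differentiable (at x)"
  shows "partial j (\<lambda>x. f x + g x) x = partial j f x + partial j g x"
proof -
  have "(f has_derivative frechet_derivative f (at x)) (at x)"
    "(g has_derivative frechet_derivative g (at x)) (at x)"
    using assms frechet_derivative_works by blast+
  from partial_eqI[OF has_derivative_add[OF this]] show ?thesis by (simp add: partial_def)
qed

lemma partial_const [simp]: "partial j (\<lambda>x. c) = (\<lambda>x. 0)"
proof
  fix x :: "real^'a"
  show "partial j (\<lambda>x. c) x = 0"
    using partial_eqI[of "\<lambda>x. c" "\<lambda>x. 0" x j] by simp
qed

lemma bounded_linear_differentiable:
  "bounded_linear T \<Longrightarrow> f differentiable (at x) \<Longrightarrow> (\<lambda>x. T (f x)) differentiable (at x)"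
  unfolding differentiable_def by (blast intro: bounded_linear.has_derivative)

lemma Ck_bounded_linear:
  assumes "bounded_linear T"
  shows "Ck m f \<Longrightarrow> Ck m (\<lambda>x. T (f x))"
proof (induction m arbitrary: f)
  case 0
  then show ?case using bounded_linear.continuous_on[OF assms] by simp
next
  case (Suc m)
  then have "partial j (\<lambda>x. T (f x)) = (\<lambda>x. T (partial j f x))" for j
    by (intro ext partial_bounded_linear[OF assms]) simp
  then show ?case using Suc by (auto intro: bounded_linear_differentiable[OF assms])
qed

lemma Ck_add: "Ck m f \<Longrightarrow> Ck m g \<Longrightarrow> Ck m (\<lambda>x. f x + g x)"
proof (induction m arbitrary: f g)
  case 0
  then show ?case by (auto intro: continuous_intros)
next
  case (Suc m)
  then have "partial j (\<lambda>x. f x + g x) = (\<lambda>x. partial j f x + partial j g x)" for j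
    by (intro ext partial_add) simp_all
  then show ?case using Suc by (auto intro: differentiable_add)
qed

lemma Ck_zero: "Ck m (\<lambda>x. 0)"
  by (induction m) auto

lemma Ck_sum: "finite A \<Longrightarrow> (\<And>i. i \<in> A \<Longrightarrow> Ck m (f i)) \<Longrightarrow> Ck m (\<lambda>x. \<Sum>i\<in>A. f i x)"
  by (induction A rule: finite_induct) (auto intro: Ck_add Ck_zero)

section \<open>Degrees of forms and the spaces of test forms\<close>

lemma Lam_subspace: "subspace (Lam k)"
  by (auto simp: subspace_def Lam_def)

lemma dx_wedge_in_Lam:
  fixes j :: "'n::{finite,linorder}"
  assumes "w \<in> Lam k"
  shows "dx_wedge j w \<in> Lam (Suc k)"
  unfolding Lam_def
proof (intro CollectI allI impI)
  fix J :: "'n set" assume J: "card J \<noteq> Suc k"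
  show "dx_wedge j w $ J = 0"
  proof (cases "j \<in> J")
    case True
    then have "Suc (card (J - {j})) = card J"
      by (intro card_Suc_Diff1) simp_all
    with J have "card (J - {j}) \<noteq> k" by simp
    then have "w $ (J - {j}) = 0" using assms unfolding Lam_def by blast
    then show ?thesis by (simp add: dx_wedge_def)
  qed (simp add: dx_wedge_def)
qed

lemma contract_in_Lam:
  fixes j :: "'n::{finite,linorder}"
  assumes "w \<in> Lam (Suc k)"
  shows "contract j w \<in> Lam k"
  unfolding Lam_def
proof (intro CollectI allI impI)
  fix I :: "'n set" assume I: "card I \<noteq> k"
  show "contract j w $ I = 0"
  proof (cases "j \<in> I")
    case False
    then have "card (insert j I) \<noteq> Suc k" using I by simp
    then have "w $ (insert j I) = 0" using assms unfolding Lam_def by blast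
    then show ?thesis by (simp add: contract_def)
  qed (simp add: contract_def)
qed

lemma test_formsD:
  assumes "u \<in> test_forms \<Omega> k"
  shows "Ck m u" "u differentiable (at x)" "continuous_on UNIV u" "u x \<in> Lam k"
    "compact (closure {x. u x \<noteq> 0})" "closure {x. u x \<noteq> 0} \<subseteq> \<Omega>"
proof -
  have *: "Ck m u" for m using assms by (simp add: test_forms_def)
  show "Ck m u" by (rule *)
  show "u differentiable (at x)" using *[of 1] by simp
  show "continuous_on UNIV u" using *[of 0] by simp
qed (use assms in \<open>auto simp: test_forms_def\<close>)

text \<open>Any compact subset of \<Omega> outside which \<open>u\<close> vanishes may replace the
  exact support; for a sum this is the union of the two supports.\<close>

lemma test_formsI:
  assumes "\<And>m. Ck m u" "\<And>x. u x \<in> Lam k" "compact S" "S \<subseteq> \<Omega>" "\<And>x. x \<notin> S \<Longrightarrow> u x = 0"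
  shows "u \<in> test_forms \<Omega> k"
proof -
  have "closure {x. u x \<noteq> 0} \<subseteq> S"
    using assms(3,5) by (intro closure_minimal) (auto intro: compact_imp_closed)
  moreover from this have "compact (closure {x. u x \<noteq> 0})"
    using compact_Int_closed[OF assms(3) closed_closure[of "{x. u x \<noteq> 0}"]]
    by (simp add: Int_absorb1 del: compact_closure)
  ultimately show ?thesis
    using assms(1,2,4) by (simp add: test_forms_def)
qed

lemma test_forms_zero: "(\<lambda>x. 0) \<in> test_forms \<Omega> k"
  by (rule test_formsI[of _ _ "{}"]) (auto simp: Ck_zero Lam_def)

lemma test_forms_outside: "x \<notin> closure {x. u x \<noteq> 0} \<Longrightarrow> u x = 0"
  using closure_subset[of "{x. u x \<noteq> 0}"] by auto

lemma test_forms_add: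
  assumes "u \<in> test_forms \<Omega> k" "v \<in> test_forms \<Omega> k"
  shows "(\<lambda>x. u x + v x) \<in> test_forms \<Omega> k"
proof (rule test_formsI)
  let ?S = "closure {x. u x \<noteq> 0} \<union> closure {x. v x \<noteq> 0}"
  show "compact ?S" "?S \<subseteq> \<Omega>"
    using test_formsD(5,6)[OF assms(1)] test_formsD(5,6)[OF assms(2)] by (auto intro: compact_Un)
  show "u x + v x = 0" if "x \<notin> ?S" for x
    using that test_forms_outside[of x u] test_forms_outside[of x v] by auto
  show "Ck m (\<lambda>x. u x + v x)" for m
    by (rule Ck_add[OF test_formsD(1)[OF assms(1)] test_formsD(1)[OF assms(2)]])
  show "u x + v x \<in> Lam k" for x
    by (rule subspace_add[OF Lam_subspace test_formsD(4)[OF assms(1)] test_formsD(4)[OF assms(2)]])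
qed

lemma test_forms_scaleR:
  assumes "u \<in> test_forms \<Omega> k"
  shows "(\<lambda>x. c *\<^sub>R u x) \<in> test_forms \<Omega> k"
proof (rule test_formsI)
  show "c *\<^sub>R u x = 0" if "x \<notin> closure {x. u x \<noteq> 0}" for x
    using that test_forms_outside[of x u] by auto
  show "Ck m (\<lambda>x. c *\<^sub>R u x)" for m
    by (rule Ck_bounded_linear[OF bounded_linear_scaleR_right test_formsD(1)[OF assms]])
  show "c *\<^sub>R u x \<in> Lam k" for x
    by (rule subspace_scale[OF Lam_subspace test_formsD(4)[OF assms]])
qed (fact test_formsD(5,6)[OF assms])+

lemma test_forms_diff:
  assumes "u \<in> test_forms \<Omega> k" "v \<in> test_forms \<Omega> k"
  shows "(\<lambda>x. u x - v x) \<in> test_forms \<Omega> k"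
  using test_forms_add[OF assms(1) test_forms_scaleR[OF assms(2), of "-1"]] by simp

lemma partial_in_Lam:
  assumes "u \<in> test_forms \<Omega> k"
  shows "partial j u x \<in> Lam k"
proof -
  have "partial j u x $ I = 0" if "card I \<noteq> k" for I
  proof -
    have "partial j u x $ I = partial j (\<lambda>x. u x $ I) x"
      using partial_bounded_linear[OF bounded_linear_vec_nth test_formsD(2)[OF assms]] by metis
    also have "(\<lambda>x. u x $ I) = (\<lambda>x. 0)"
      using test_formsD(4)[OF assms] that by (auto simp: Lam_def)
    finally show ?thesis by simp
  qed
  then show ?thesis by (simp add: Lam_def)
qed

text \<open>The common part of d and d*: \<open>T\<close> is instantiated with
  \<open>dx_wedge\<close> and with \<open>contract\<close>.\<close>

lemma first_order_test_forms:
  assumes T: "\<And>j. linear (T j)" "\<And>j w. w \<in> Lam k \<Longrightarrow> T j w \<in> Lam k'"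
    and u: "u \<in> test_forms \<Omega> k"
  shows "(\<lambda>x. \<Sum>j\<in>UNIV. T j (partial j u x)) \<in> test_forms \<Omega> k'"
proof (rule test_formsI)
  have "Ck m (partial j u)" for m j
    using test_formsD(1)[OF u, of "Suc m"] by simp
  then show "Ck m (\<lambda>x. \<Sum>j\<in>UNIV. T j (partial j u x))" for m
    using T(1) unfolding linear_conv_bounded_linear by (intro Ck_sum) (rule finite, rule Ck_bounded_linear)
  show "(\<Sum>j\<in>UNIV. T j (partial j u x)) \<in> Lam k'" for x
    by (rule subspace_sum[OF Lam_subspace]) (rule T(2)[OF partial_in_Lam[OF u]])
  show "(\<Sum>j\<in>UNIV. T j (partial j u x)) = 0" if "x \<notin> closure {x. u x \<noteq> 0}" for x
    using partial_eq_0_outside[OF that] linear_0[OF T(1)] by simp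
qed (fact test_formsD(5,6)[OF u])+

lemma ext_d_test_forms:
  assumes "u \<in> test_forms \<Omega> k"
  shows "ext_d u \<in> test_forms \<Omega> (Suc k)"
proof -
  have "ext_d u = (\<lambda>x. \<Sum>j\<in>UNIV. dx_wedge j (partial j u x))"
    by (rule ext) (rule ext_d_def)
  then show ?thesis
    using first_order_test_forms[OF linear_dx_wedge dx_wedge_in_Lam assms] by (simp only:)
qed

lemma codiff_test_forms:
  assumes "u \<in> test_forms \<Omega> (Suc k)"
  shows "codiff u \<in> test_forms \<Omega> k"
proof -
  have "codiff u = (\<lambda>x. (-1) *\<^sub>R (\<Sum>j\<in>UNIV. contract j (partial j u x)))"
    by (rule ext) (simp add: codiff_def)
  then show ?thesis
    using test_forms_scaleR[OF first_order_test_forms[OF linear_contract contract_in_Lam assms]]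
    by (simp only:)
qed

lemma ext_d_add:
  assumes "u \<in> test_forms \<Omega> k" "v \<in> test_forms \<Omega> k"
  shows "ext_d (\<lambda>x. u x + v x) x = ext_d u x + ext_d v x"
  unfolding ext_d_def
  using partial_add[OF test_formsD(2)[OF assms(1)] test_formsD(2)[OF assms(2)]]
  by (simp add: linear_add[OF linear_dx_wedge] sum.distrib)

lemma codiff_add:
  assumes "u \<in> test_forms \<Omega> k" "v \<in> test_forms \<Omega> k"
  shows "codiff (\<lambda>x. u x + v x) x = codiff u x + codiff v x"
  unfolding codiff_def
  using partial_add[OF test_formsD(2)[OF assms(1)] test_formsD(2)[OF assms(2)]]
  by (simp add: linear_add[OF linear_contract] sum.distrib)

lemma ext_d_scaleR:
  assumes "u \<in> test_forms \<Omega> k"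
  shows "ext_d (\<lambda>x. c *\<^sub>R u x) x = c *\<^sub>R ext_d u x"
  unfolding ext_d_def
  using partial_bounded_linear[OF bounded_linear_scaleR_right test_formsD(2)[OF assms]]
  by (simp add: linear_scale[OF linear_dx_wedge] scaleR_sum_right)

lemma codiff_scaleR:
  assumes "u \<in> test_forms \<Omega> k"
  shows "codiff (\<lambda>x. c *\<^sub>R u x) x = c *\<^sub>R codiff u x"
  unfolding codiff_def
  using partial_bounded_linear[OF bounded_linear_scaleR_right test_formsD(2)[OF assms]]
  by (simp add: linear_scale[OF linear_contract] scaleR_sum_right)

section \<open>A smooth compactly supported form with nonzero codifferential\<close>

definition flat :: "nat \<Rightarrow> real \<Rightarrow> real" where
  "flat k t = (if t > 0 then (1/t) ^ k / exp (1/t) else 0)"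

text \<open>Substituting s = 1/t turns the limit from the right into s^k / e^s
  \<longlonglongrightarrow> 0; from the left the function is zero.\<close>

lemma flat_tendsto_0: "(flat k \<longlongrightarrow> 0) (at 0)"
proof -
  have "filterlim (\<lambda>t. 1 / t :: real) at_top (at_right 0)"
    using filterlim_inverse_at_top_right by (simp add: inverse_eq_divide)
  from filterlim_compose[OF tendsto_power_div_exp_0 this]
  have "((\<lambda>t. (1/t) ^ k / exp (1/t)) \<longlongrightarrow> 0) (at_right (0::real))" .
  moreover have "\<forall>\<^sub>F t in at_right 0. (1/t) ^ k / exp (1/t) = flat k t"
    by (auto simp: flat_def eventually_at_filter)
  ultimately have "(flat k \<longlongrightarrow> 0) (at_right 0)"
    using Lim_transform_eventually by blast
  moreover have "\<forall>\<^sub>F t in at_left 0. 0 = flat k t"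
    by (auto simp: flat_def eventually_at_filter)
  then have "(flat k \<longlongrightarrow> 0) (at_left 0)"
    using Lim_transform_eventually[OF tendsto_const] by blast
  ultimately show ?thesis by (simp add: filterlim_split_at)
qed

text \<open>For t > 0, \<open>flat k t\<close> is t^-k e^(-1/t). Differentiation stays within the
  span of these functions, which is why the powers are carried along with the classical
  e^(-1/t).\<close>

lemma flat_has_derivative:
  "(flat k has_real_derivative flat (k + 2) t - real k * flat (k + 1) t) (at t)"
proof -
  consider "t > 0" | "t < 0" | "t = 0" by linarith
  then show ?thesis
  proof cases
    case 1
    have "((\<lambda>t. (1/t) ^ k / exp (1/t)) has_real_derivative
        flat (k + 2) t - real k * flat (k + 1) t) (at t)"
    proof (cases k)
      case 0
      show ?thesis using 1 unfolding 0
        by (auto intro!: derivative_eq_intros simp: flat_def field_simps power2_eq_square)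
    next
      case (Suc n)
      show ?thesis using 1 unfolding Suc
        by (auto intro!: derivative_eq_intros simp: flat_def field_simps power2_eq_square)
          (metis One_nat_def mult.commute neq0_conv power_minus_mult)
    qed
    then show ?thesis
      by (rule has_field_derivative_transform_within_open[of _ _ _ "{0<..}"])
        (use 1 in \<open>auto simp: flat_def\<close>)
  next
    case 2
    have "((\<lambda>t. 0) has_real_derivative 0) (at t)" by simp
    then have "(flat k has_real_derivative 0) (at t)"
      by (rule has_field_derivative_transform_within_open[of _ _ _ "{..<0}"])
        (use 2 in \<open>auto simp: flat_def\<close>)
    with 2 show ?thesis by (simp add: flat_def)
  next
    case 3
    \<comment> \<open>At 0 the difference quotient of \<open>flat k\<close> is
      \<open>flat (Suc k)\<close>, which tends to 0.\<close>
    have "((\<lambda>h. (flat k (0 + h) - flat k 0) / h) \<longlongrightarrow> 0) (at 0)"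
    proof (rule Lim_transform_eventually[OF flat_tendsto_0[of "Suc k"]])
      show "\<forall>\<^sub>F h in at 0. flat (Suc k) h = (flat k (0 + h) - flat k 0) / h"
        by (auto simp: flat_def eventually_at_filter)
    qed
    with 3 show ?thesis by (simp add: DERIV_def flat_def)
  qed
qed

text \<open>A set of functions that contains a bump function and is closed under partial derivatives, so that
  all its members are smooth.\<close>

inductive flat_algebra :: "real \<Rightarrow> real^'n \<Rightarrow> (real^'n::finite \<Rightarrow> real) \<Rightarrow> bool" for r a where
  "flat_algebra r a (\<lambda>x. flat k (r - (norm (x - a))\<^sup>2))"
| "flat_algebra r a (\<lambda>x. c)"
| "flat_algebra r a (\<lambda>x. x $ i)"
| "flat_algebra r a f \<Longrightarrow> flat_algebra r a g \<Longrightarrow> flat_algebra r a (\<lambda>x. f x + g x)"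
| "flat_algebra r a f \<Longrightarrow> flat_algebra r a g \<Longrightarrow> flat_algebra r a (\<lambda>x. f x * g x)"

lemma flat_radial_has_derivative:
  "((\<lambda>x. flat k (r - (norm (x - a))\<^sup>2)) has_derivative
    (\<lambda>h. (flat (k + 2) (r - (norm (x - a))\<^sup>2) - real k * flat (k + 1) (r - (norm (x - a))\<^sup>2)) *
      (- 2 * ((x - a) \<bullet> h)))) (at (x :: 'a::real_inner))"
proof -
  have "((\<lambda>x. r - (norm (x - a))\<^sup>2) has_derivative (\<lambda>h. - 2 * ((x - a) \<bullet> h))) (at x)"
    unfolding power2_norm_eq_inner
    by (auto intro!: derivative_eq_intros simp: inner_commute)
  from has_derivative_compose[OF this flat_has_derivative[of k, unfolded has_field_derivative_def]]
  show ?thesis by simp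
qed

lemma flat_algebra_partial:
  assumes "flat_algebra r a f"
  shows "(\<forall>x. f differentiable (at x)) \<and> (\<forall>j. flat_algebra r a (partial j f))"
  using assms
proof induction
  case (1 k)
  have "partial j (\<lambda>x. flat k (r - (norm (x - a))\<^sup>2)) = (\<lambda>x.
     (flat (k + 2) (r - (norm (x - a))\<^sup>2) + (- real k) * flat (k + 1) (r - (norm (x - a))\<^sup>2)) *
      (2 * a $ j + (- 2) * x $ j))" for j
    using partial_eqI[OF flat_radial_has_derivative[of k r a]]
    by (auto simp: fun_eq_iff inner_axis algebra_simps)
  then have "flat_algebra r a (partial j (\<lambda>x. flat k (r - (norm (x - a))\<^sup>2)))" for j
    by (simp only:) (intro flat_algebra.intros)
  then show ?case
    using flat_radial_has_derivative[of k r a] unfolding differentiable_def by blast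
next
  case (2 c)
  then show ?case using flat_algebra.intros(2)[of r a 0] by simp
next
  case (3 i)
  have *: "((\<lambda>x. x $ i) has_derivative (\<lambda>h. h $ i)) (at x)" for x :: "real^'a"
    by (rule bounded_linear_imp_has_derivative[OF bounded_linear_vec_nth])
  have "partial j (\<lambda>x. x $ i) = (\<lambda>x. axis j 1 $ i)" for j
    using partial_eqI[OF *] by auto
  then show ?case
    using * flat_algebra.intros(2)[of r a] unfolding differentiable_def by auto
next
  case (4 f g)
  have "partial j (\<lambda>x. f x + g x) = (\<lambda>x. partial j f x + partial j g x)" for j
    using 4 by (intro ext partial_add) auto
  with 4 show ?case by (auto intro: flat_algebra.intros(4))
next
  case (5 f g)
  have "((\<lambda>x. f x * g x) has_derivative (\<lambda>h. f x * frechet_derivative g (at x) h +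
      frechet_derivative f (at x) h * g x)) (at x)" for x
    using 5 frechet_derivative_works by (intro has_derivative_mult) blast+
  from partial_eqI[OF this]
  have "partial j (\<lambda>x. f x * g x) = (\<lambda>x. f x * partial j g x + partial j f x * g x)" for j
    by (auto simp: partial_def)
  moreover have "flat_algebra r a (\<lambda>x. f x * partial j g x + partial j f x * g x)" for j
    using 5 by (intro flat_algebra.intros(4,5)) auto
  ultimately show ?case using 5 by simp
qed

lemma flat_algebra_Ck: "flat_algebra r a f \<Longrightarrow> Ck m f"
proof (induction m arbitrary: f)
  case 0
  then show ?case
    using flat_algebra_partial[OF 0]
    by (simp add: continuous_on_eq_continuous_within differentiable_imp_continuous_within)
next
  case (Suc m)
  then show ?case using flat_algebra_partial[OF Suc.prems] by auto
qed

text \<open>Take a radial bump f times a basis form dx_I. For \<open>j\<close> in \<open>I\<close>,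
  one coefficient of the codifferential is the j-th partial derivative of f up to sign, and this is
  nonzero off the centre in direction j.\<close>

lemma exists_test_form_codiff_nonzero:
  fixes \<Omega> :: "(real^'n::{finite,linorder}) set"
  assumes "open \<Omega>" "\<Omega> \<noteq> {}" "Suc k \<le> CARD('n)"
  shows "\<exists>u\<in>test_forms \<Omega> (Suc k). \<exists>x\<in>\<Omega>. codiff u x \<noteq> 0"
proof -
  obtain a r where a: "0 < r" "cball a r \<subseteq> \<Omega>"
    using assms(1,2) open_contains_cball by (metis ex_in_conv)
  obtain I :: "'n set" where I: "card I = Suc k"
    using obtain_subset_with_card_n[OF assms(3)] by metis
  then obtain j where j: "j \<in> I" by fastforce
  define f where "f x = flat 0 (r\<^sup>2 - (norm (x - a))\<^sup>2)" for x
  define u where "u x = f x *\<^sub>R axis I (1::real)" for x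
  have Cf: "Ck m f" for m
    unfolding f_def by (rule flat_algebra_Ck) (rule flat_algebra.intros)
  have u: "u \<in> test_forms \<Omega> (Suc k)"
  proof (rule test_formsI)
    show "Ck m u" for m
      unfolding u_def by (rule Ck_bounded_linear[OF bounded_linear_scaleR_left Cf])
    show "u x = 0" if "x \<notin> cball a r" for x
    proof -
      have "r < norm (x - a)" using that by (simp add: dist_norm norm_minus_commute)
      then have "r\<^sup>2 < (norm (x - a))\<^sup>2" using a by (intro power_strict_mono) auto
      then show ?thesis by (simp add: u_def f_def flat_def)
    qed
  qed (use a I in \<open>auto simp: u_def Lam_def axis_def\<close>)
  have pu: "partial i u x = partial i f x *\<^sub>R axis I 1" for i x
    unfolding u_def using Cf[of 1]
    by (subst partial_bounded_linear[OF bounded_linear_scaleR_left]) auto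
  \<comment> \<open>Only \<open>i = j\<close> contributes: it is the only index outside
    \<open>I - {j}\<close> whose insertion gives back \<open>I\<close>.\<close>
  have cu: "codiff u x $ (I - {j}) = - wsign j (I - {j}) * partial j f x" for x
  proof -
    have "contract i (partial i u x) $ (I - {j}) =
        (if i = j then wsign j (I - {j}) * partial j f x else 0)" for i
      using j unfolding pu contract_def by (auto simp: axis_def insert_absorb)
    then show ?thesis by (simp add: codiff_def)
  qed
  \<comment> \<open>The centre \<open>a\<close> is a critical point of \<open>f\<close>, hence the
    shift by half the radius. It keeps the argument of \<open>flat\<close> positive, namely 3 r^2 /
    4, and makes the inner derivative -r.\<close>
  define x where "x = a + (r/2) *\<^sub>R axis j 1"
  have nx: "norm (x - a) = r / 2" using a by (simp add: x_def)
  have "r\<^sup>2 - (r/2)\<^sup>2 > 0" using a by (simp add: power2_eq_square field_simps)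
  then have "flat 2 (r\<^sup>2 - (r/2)\<^sup>2) > 0" by (simp add: flat_def)
  moreover have "partial j f x = flat 2 (r\<^sup>2 - (r/2)\<^sup>2) * (- r)"
    unfolding f_def partial_eqI[OF flat_radial_has_derivative] nx
    by (simp add: x_def inner_axis numeral_2_eq_2)
  ultimately have "partial j f x \<noteq> 0" using a by simp
  then have "codiff u x \<noteq> 0"
    using cu[of x] by (auto simp: wsign_def)
  moreover have "x \<in> \<Omega>" using a nx by (auto simp: dist_norm norm_minus_commute)
  ultimately show ?thesis using u by blast
qed


section \<open>Square integrable forms as a subspace\<close>

lemma closure_subspace_normed:
  fixes S :: "'a::real_normed_vector set"
  assumes S: "subspace S"
  shows "subspace (closure S)"
  unfolding subspace_def
proof (intro conjI ballI allI)
  show "0 \<in> closure S"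
    using subspace_0[OF S] closure_subset by blast
  fix x y c assume x: "x \<in> closure S"
  then obtain a where a: "\<And>n. a n \<in> S" "a \<longlonglongrightarrow> x"
    unfolding closure_sequential by blast
  have "\<And>n. c *\<^sub>R a n \<in> S" using a(1) subspace_scale[OF S] by blast
  moreover have "(\<lambda>n. c *\<^sub>R a n) \<longlonglongrightarrow> c *\<^sub>R x" by (intro tendsto_intros a(2))
  ultimately show "c *\<^sub>R x \<in> closure S"
    unfolding closure_sequential by (intro exI[of _ "\<lambda>n. c *\<^sub>R a n"]) auto
  assume "y \<in> closure S"
  then obtain b where b: "\<And>n. b n \<in> S" "b \<longlonglongrightarrow> y"
    unfolding closure_sequential by blast
  have "\<And>n. a n + b n \<in> S" using a(1) b(1) subspace_add[OF S] by blast
  moreover have "(\<lambda>n. a n + b n) \<longlonglongrightarrow> x + y" by (intro tendsto_intros a(2) b(2))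
  ultimately show "x + y \<in> closure S"
    unfolding closure_sequential by (intro exI[of _ "\<lambda>n. a n + b n"]) auto
qed

type_synonym 'n lsq_form = "(real^'n, real^('n set)) lsq"

text \<open>Extension by zero embeds the L2 forms on \<Omega> isometrically. The indicator also
  discards the values outside \<Omega>, on which \<open>L2\<close> puts no condition.\<close>

definition lsq_of :: "(real^'n::finite) set \<Rightarrow> 'n form \<Rightarrow> 'n lsq_form" where
  "lsq_of \<Omega> u = abs_lsq (\<lambda>x. indicator \<Omega> x *\<^sub>R u x)"

lemma L2_square_integrable:
  assumes "open \<Omega>" "u \<in> L2 \<Omega> k"
  shows "square_integrable lebesgue (\<lambda>x. indicator \<Omega> x *\<^sub>R u x)"
proof -
  have "\<Omega> \<inter> space lebesgue \<in> sets lebesgue" using assms(1) by simp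
  moreover have "(\<lambda>x. (norm (indicator \<Omega> x *\<^sub>R u x))\<^sup>2) =
      (\<lambda>x. indicator \<Omega> x *\<^sub>R (norm (u x))\<^sup>2)"
    by (auto simp: fun_eq_iff indicator_def)
  ultimately show ?thesis
    using assms(2) by (simp add: square_integrable_def L2_def borel_measurable_restrict_space_iff
        integrable_restrict_space)
qed

lemma L2_inner_lsq_of:
  assumes "open \<Omega>" "u \<in> L2 \<Omega> k" "v \<in> L2 \<Omega> k'"
  shows "L2_inner \<Omega> u v = lsq_of \<Omega> u \<bullet> lsq_of \<Omega> v"
proof -
  have "L2_inner \<Omega> u v = (\<integral>x. indicator \<Omega> x *\<^sub>R (u x \<bullet> v x) \<partial>lebesgue)"
    unfolding L2_inner_def using assms(1) by (intro integral_restrict_space) simp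
  also have "(\<lambda>x. indicator \<Omega> x *\<^sub>R (u x \<bullet> v x)) =
      (\<lambda>x. (indicator \<Omega> x *\<^sub>R u x) \<bullet> (indicator \<Omega> x *\<^sub>R v x))"
    by (auto simp: fun_eq_iff indicator_def)
  finally show ?thesis
    using assms by (simp add: lsq_of_def abs_lsq_arith(3) L2_square_integrable)
qed

lemma L2_norm_lsq_of:
  assumes "open \<Omega>" "u \<in> L2 \<Omega> k"
  shows "L2_norm \<Omega> u = norm (lsq_of \<Omega> u)"
  using L2_inner_lsq_of[OF assms assms(2)]
  by (simp add: L2_norm_def L2_inner_def norm_eq_sqrt_inner power2_norm_eq_inner)

lemma lsq_of_eq_iff:
  assumes "open \<Omega>" "u \<in> L2 \<Omega> k" "v \<in> L2 \<Omega> k'"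
  shows "lsq_of \<Omega> u = lsq_of \<Omega> v \<longleftrightarrow> (AE x in lebesgue_on \<Omega>. u x = v x)"
proof -
  have "(AE x in lebesgue_on \<Omega>. u x = v x) \<longleftrightarrow> (AE x in lebesgue. x \<in> \<Omega> \<longrightarrow> u x = v x)"
    using assms(1) by (intro AE_restrict_space_iff) simp
  also have "\<dots> \<longleftrightarrow> (AE x in lebesgue. indicator \<Omega> x *\<^sub>R u x = indicator \<Omega> x *\<^sub>R v x)"
    by (intro AE_cong) (auto simp: indicator_def)
  finally show ?thesis
    using assms by (simp add: lsq_of_def abs_lsq_eq_iff L2_square_integrable)
qed

lemma L2_memberI:
  assumes "open \<Omega>" "square_integrable lebesgue (\<lambda>x. indicator \<Omega> x *\<^sub>R u x)"
    and "\<And>x. x \<in> \<Omega> \<Longrightarrow> u x \<in> Lam k"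
  shows "u \<in> L2 \<Omega> k"
proof -
  have "\<Omega> \<inter> space lebesgue \<in> sets lebesgue" using assms(1) by simp
  moreover have "(\<lambda>x. (norm (indicator \<Omega> x *\<^sub>R u x))\<^sup>2) =
      (\<lambda>x. indicator \<Omega> x *\<^sub>R (norm (u x))\<^sup>2)"
    by (auto simp: fun_eq_iff indicator_def)
  ultimately show ?thesis
    using assms by (simp add: square_integrable_def L2_def borel_measurable_restrict_space_iff
        integrable_restrict_space)
qed

lemma L2_zero: "(\<lambda>x. 0) \<in> L2 \<Omega> k"
  by (simp add: L2_def Lam_def)

lemma lsq_of_zero: "lsq_of \<Omega> (\<lambda>x. 0) = 0"
  by (simp add: lsq_of_def zero_lsq.abs_eq[symmetric])

lemma L2_add:
  assumes "open \<Omega>" "u \<in> L2 \<Omega> k" "v \<in> L2 \<Omega> k"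
  shows "(\<lambda>x. u x + v x) \<in> L2 \<Omega> k"
    and "lsq_of \<Omega> (\<lambda>x. u x + v x) = lsq_of \<Omega> u + lsq_of \<Omega> v"
proof -
  note s = L2_square_integrable[OF assms(1,2)] L2_square_integrable[OF assms(1,3)]
  show "(\<lambda>x. u x + v x) \<in> L2 \<Omega> k"
    using square_integrable_add[OF s] assms(2,3)
    by (intro L2_memberI[OF assms(1)])
      (auto simp: L2_def scaleR_add_right intro: subspace_add[OF Lam_subspace])
  show "lsq_of \<Omega> (\<lambda>x. u x + v x) = lsq_of \<Omega> u + lsq_of \<Omega> v"
    unfolding lsq_of_def abs_lsq_arith(1)[OF s] by (simp add: scaleR_add_right)
qed

lemma L2_scaleR:
  assumes "open \<Omega>" "u \<in> L2 \<Omega> k"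
  shows "(\<lambda>x. c *\<^sub>R u x) \<in> L2 \<Omega> k"
    and "lsq_of \<Omega> (\<lambda>x. c *\<^sub>R u x) = c *\<^sub>R lsq_of \<Omega> u"
proof -
  note s = L2_square_integrable[OF assms]
  have eq: "(\<lambda>x. indicator \<Omega> x *\<^sub>R c *\<^sub>R u x) = (\<lambda>x. c *\<^sub>R indicator \<Omega> x *\<^sub>R u x)"
    by (simp add: mult.commute)
  show "(\<lambda>x. c *\<^sub>R u x) \<in> L2 \<Omega> k"
  proof (rule L2_memberI[OF assms(1)])
    show "square_integrable lebesgue (\<lambda>x. indicator \<Omega> x *\<^sub>R c *\<^sub>R u x)"
      unfolding eq by (rule square_integrable_scaleR[OF s])
    show "c *\<^sub>R u x \<in> Lam k" if "x \<in> \<Omega>" for x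
      using assms(2) that by (simp add: L2_def subspace_scale[OF Lam_subspace])
  qed
  show "lsq_of \<Omega> (\<lambda>x. c *\<^sub>R u x) = c *\<^sub>R lsq_of \<Omega> u"
    unfolding lsq_of_def scaleR_abs_lsq[OF s] eq ..
qed

lemma L2_diff:
  assumes "open \<Omega>" "u \<in> L2 \<Omega> k" "v \<in> L2 \<Omega> k"
  shows "(\<lambda>x. u x - v x) \<in> L2 \<Omega> k"
    and "lsq_of \<Omega> (\<lambda>x. u x - v x) = lsq_of \<Omega> u - lsq_of \<Omega> v"
proof -
  note s = L2_scaleR[OF assms(1,3), of "-1"]
  show "(\<lambda>x. u x - v x) \<in> L2 \<Omega> k" "lsq_of \<Omega> (\<lambda>x. u x - v x) = lsq_of \<Omega> u - lsq_of \<Omega> v"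
    using L2_add[OF assms(1,2) s(1)] s(2) by simp_all
qed

lemma subspace_lsq_of_L2:
  assumes "open \<Omega>"
  shows "subspace (lsq_of \<Omega> ` L2 \<Omega> k)"
  unfolding subspace_def
proof (intro conjI ballI allI)
  show "0 \<in> lsq_of \<Omega> ` L2 \<Omega> k"
    unfolding lsq_of_zero[of \<Omega>, symmetric] by (rule imageI) (rule L2_zero)
  fix x y c assume "x \<in> lsq_of \<Omega> ` L2 \<Omega> k"
  then obtain u where u: "u \<in> L2 \<Omega> k" "x = lsq_of \<Omega> u" by blast
  show "c *\<^sub>R x \<in> lsq_of \<Omega> ` L2 \<Omega> k"
    unfolding u(2) L2_scaleR(2)[OF assms u(1), symmetric]
    by (rule imageI) (rule L2_scaleR(1)[OF assms u(1)])
  assume "y \<in> lsq_of \<Omega> ` L2 \<Omega> k"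
  then obtain v where v: "v \<in> L2 \<Omega> k" "y = lsq_of \<Omega> v" by blast
  show "x + y \<in> lsq_of \<Omega> ` L2 \<Omega> k"
    unfolding u(2) v(2) L2_add(2)[OF assms u(1) v(1), symmetric]
    by (rule imageI) (rule L2_add(1)[OF assms u(1) v(1)])
qed

section \<open>Closedness of the space of square integrable k-forms\<close>

definition Lam_proj :: "nat \<Rightarrow> real^('n::finite set) \<Rightarrow> real^('n set)" where
  "Lam_proj k w = (\<chi> I. if card I = k then w $ I else 0)"

lemma Lam_proj:
  shows "linear (Lam_proj k)" "Lam_proj k w \<in> Lam k" "w \<in> Lam k \<Longrightarrow> Lam_proj k w = w"
    "norm (Lam_proj k w) \<le> norm w"
proof -
  show "norm (Lam_proj k w) \<le> norm w"
    by (rule norm_le_componentwise_cart) (simp add: Lam_proj_def)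
qed (auto intro!: linearI simp: Lam_proj_def Lam_def vec_eq_iff)

lemma norm_abs_lsq_mono:
  assumes "square_integrable lebesgue f" "square_integrable lebesgue g"
    "\<And>x. norm (f x) \<le> norm (g x)"
  shows "norm (abs_lsq f) \<le> norm (abs_lsq g)"
  unfolding norm_abs_lsq[OF assms(1)] norm_abs_lsq[OF assms(2)]
  by (intro real_sqrt_le_mono integral_mono power_mono assms(3) norm_ge_zero
      square_integrableD(2)[OF assms(1)] square_integrableD(2)[OF assms(2)])

text \<open>Cutting the limit off outside \<Omega> and projecting its values onto the k-forms gives
  an element of L2. The operation fixes every \<open>X n\<close> and does not increase distances, so
  \<open>X\<close> converges to the modified function too, and limits are unique.\<close>

lemma closed_lsq_of_L2:
  assumes \<Omega>: "open \<Omega>"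
  shows "closed (lsq_of \<Omega> ` L2 \<Omega> k)"
  unfolding closed_sequential_limits
proof (intro allI impI, elim conjE)
  fix X l assume X: "\<forall>n. X n \<in> lsq_of \<Omega> ` L2 \<Omega> k" "X \<longlonglongrightarrow> l"
  then have "\<forall>n. \<exists>u. u \<in> L2 \<Omega> k \<and> X n = lsq_of \<Omega> u" by blast
  then obtain u where u: "\<And>n. u n \<in> L2 \<Omega> k" "\<And>n. X n = lsq_of \<Omega> (u n)" by metis
  obtain g where g: "square_integrable lebesgue g" "l = abs_lsq g"
    by (rule abs_lsq_cases)
  define w where "w x = Lam_proj k (g x)" for x
  have blp: "bounded_linear (Lam_proj k :: real^('a set) \<Rightarrow> _)"
    using Lam_proj(1) by (simp add: linear_conv_bounded_linear)
  have gm: "g \<in> borel_measurable lebesgue" by (rule square_integrableD(1)[OF g(1)])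
  have wm: "w \<in> borel_measurable lebesgue"
    unfolding w_def
    using borel_measurable_continuous_onI[OF bounded_linear.continuous_on[OF blp continuous_on_id]] gm
    by (rule measurable_compose[rotated])
  have "(\<lambda>x. indicator \<Omega> x *\<^sub>R w x) \<in> borel_measurable lebesgue"
    using \<Omega> wm by (intro borel_measurable_scaleR borel_measurable_indicator) auto
  moreover have "AE x in lebesgue. norm (indicator \<Omega> x *\<^sub>R w x) \<le> norm (g x)"
    using Lam_proj(4) by (auto simp: w_def indicator_def)
  ultimately have ws: "square_integrable lebesgue (\<lambda>x. indicator \<Omega> x *\<^sub>R w x)"
    by (rule square_integrable_bound[OF g(1)])
  have w: "w \<in> L2 \<Omega> k"
    by (rule L2_memberI[OF \<Omega> ws]) (simp add: w_def Lam_proj(2))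
  have "norm (X n - lsq_of \<Omega> w) \<le> norm (X n - l)" for n
  proof -
    note us = L2_square_integrable[OF \<Omega> u(1)[of n]]
    \<comment> \<open>Inside \<Omega> the left difference is the projection of the right one;
      outside \<Omega> it is zero.\<close>
    have "norm (indicator \<Omega> x *\<^sub>R u n x - indicator \<Omega> x *\<^sub>R w x) \<le>
        norm (indicator \<Omega> x *\<^sub>R u n x - g x)" for x
    proof (cases "x \<in> \<Omega>")
      case True
      have "u n x \<in> Lam k" using u(1)[of n] True by (auto simp: L2_def)
      then have "u n x - w x = Lam_proj k (u n x - g x)"
        by (simp add: w_def linear_diff[OF Lam_proj(1)] Lam_proj(3))
      then show ?thesis using True Lam_proj(4) by simp
    qed simp
    then show ?thesis
      unfolding u(2) g(2) lsq_of_def abs_lsq_arith(2)[OF us ws] abs_lsq_arith(2)[OF us g(1)]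
      using us ws g(1) by (intro norm_abs_lsq_mono square_integrable_diff)
  qed
  then have "(\<lambda>n. X n - lsq_of \<Omega> w) \<longlonglongrightarrow> 0"
    by (intro Lim_null_comparison[OF always_eventually tendsto_norm_zero[OF LIM_zero[OF X(2)]]] allI)
  then have "X \<longlonglongrightarrow> lsq_of \<Omega> w" by (rule LIM_zero_cancel)
  with X(2) have "l = lsq_of \<Omega> w" by (rule LIMSEQ_unique)
  with w show "l \<in> lsq_of \<Omega> ` L2 \<Omega> k" by blast
qed

lemma test_forms_L2:
  assumes "open \<Omega>" "u \<in> test_forms \<Omega> k"
  shows "u \<in> L2 \<Omega> k"
proof (rule L2_memberI[OF assms(1)])
  let ?S = "closure {x. u x \<noteq> 0}"
  have eq: "(\<lambda>x. indicator \<Omega> x *\<^sub>R u x) = u"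
  proof
    fix x
    show "indicator \<Omega> x *\<^sub>R u x = u x"
      using test_formsD(6)[OF assms(2)] test_forms_outside[of x u] by (cases "x \<in> \<Omega>") auto
  qed
  note c = test_formsD(3)[OF assms(2)]
  have "u \<in> borel_measurable borel" using c by (rule borel_measurable_continuous_onI)
  then have "u \<in> borel_measurable lebesgue" by (simp add: measurable_completion)
  moreover have "integrable lborel (\<lambda>x. (norm (u x))\<^sup>2)"
  proof (rule integrable_continuous_compact_support)
    show "continuous_on UNIV (\<lambda>x. (norm (u x))\<^sup>2)" by (intro continuous_intros c)
    show "compact ?S" by (rule test_formsD(5)[OF assms(2)])
    show "(norm (u x))\<^sup>2 = 0" if "x \<notin> ?S" for x using test_forms_outside[OF that] by simp
  qed
  then have "integrable lebesgue (\<lambda>x. (norm (u x))\<^sup>2)" by (rule integrable_completion[THEN iffD2, rotated])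
    (use c in \<open>auto intro!: borel_measurable_continuous_onI continuous_intros\<close>)
  ultimately show "square_integrable lebesgue (\<lambda>x. indicator \<Omega> x *\<^sub>R u x)"
    unfolding eq by (simp add: square_integrable_def)
qed (rule test_formsD(4)[OF assms(2)])


section \<open>Identification of the completion\<close>

definition hodge_dirac ::
  "(real^'n::{finite,linorder}) set \<Rightarrow> 'n form \<Rightarrow>
    'n lsq_form \<times> 'n lsq_form" where
  "hodge_dirac \<Omega> u = (lsq_of \<Omega> (codiff u), lsq_of \<Omega> (ext_d u))"

text \<open>A concrete model of the completion: by \<open>H1_seminorm_hodge_dirac\<close> a sequence
  in \<open>H10\<close> has a limit here, and two sequences share it exactly when their difference
  tends to zero.\<close>

definition H10_image ::
  "(real^'n::{finite,linorder}) set \<Rightarrow> nat \<Rightarrow>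
    ('n lsq_form \<times> 'n lsq_form) set" where
  "H10_image \<Omega> l = closure (hodge_dirac \<Omega> ` test_forms \<Omega> l)"

context
  fixes \<Omega> :: "(real^'n::{finite,linorder}) set"
  assumes \<Omega>: "open \<Omega>"
begin

text \<open>In this context the degree is mostly written \<open>l = Suc k\<close>, so that
  \<open>l - 1\<close> and \<open>l + 1\<close> in the definitions become \<open>k\<close> and
  \<open>Suc (Suc k)\<close>.\<close>

lemma codiff_L2: "u \<in> test_forms \<Omega> (Suc k) \<Longrightarrow> codiff u \<in> L2 \<Omega> k"
  by (rule test_forms_L2[OF \<Omega> codiff_test_forms])

lemma ext_d_L2: "u \<in> test_forms \<Omega> k \<Longrightarrow> ext_d u \<in> L2 \<Omega> (Suc k)"
  by (rule test_forms_L2[OF \<Omega> ext_d_test_forms])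

lemma hodge_dirac_add:
  assumes "u \<in> test_forms \<Omega> (Suc k)" "v \<in> test_forms \<Omega> (Suc k)"
  shows "hodge_dirac \<Omega> (\<lambda>x. u x + v x) = hodge_dirac \<Omega> u + hodge_dirac \<Omega> v"
proof -
  have "codiff (\<lambda>x. u x + v x) = (\<lambda>x. codiff u x + codiff v x)"
    by (rule ext) (rule codiff_add[OF assms])
  moreover have "ext_d (\<lambda>x. u x + v x) = (\<lambda>x. ext_d u x + ext_d v x)"
    by (rule ext) (rule ext_d_add[OF assms])
  ultimately show ?thesis
    unfolding hodge_dirac_def
    using L2_add(2)[OF \<Omega> codiff_L2[OF assms(1)] codiff_L2[OF assms(2)]]
      L2_add(2)[OF \<Omega> ext_d_L2[OF assms(1)] ext_d_L2[OF assms(2)]] by simp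
qed

lemma hodge_dirac_scaleR:
  assumes "u \<in> test_forms \<Omega> (Suc k)"
  shows "hodge_dirac \<Omega> (\<lambda>x. c *\<^sub>R u x) = c *\<^sub>R hodge_dirac \<Omega> u"
proof -
  have "codiff (\<lambda>x. c *\<^sub>R u x) = (\<lambda>x. c *\<^sub>R codiff u x)"
    by (rule ext) (rule codiff_scaleR[OF assms])
  moreover have "ext_d (\<lambda>x. c *\<^sub>R u x) = (\<lambda>x. c *\<^sub>R ext_d u x)"
    by (rule ext) (rule ext_d_scaleR[OF assms])
  ultimately show ?thesis
    unfolding hodge_dirac_def
    using L2_scaleR(2)[OF \<Omega> codiff_L2[OF assms]] L2_scaleR(2)[OF \<Omega> ext_d_L2[OF assms]] by simp
qed

lemma hodge_dirac_diff:
  assumes "u \<in> test_forms \<Omega> (Suc k)" "v \<in> test_forms \<Omega> (Suc k)"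
  shows "hodge_dirac \<Omega> (\<lambda>x. u x - v x) = hodge_dirac \<Omega> u - hodge_dirac \<Omega> v"
  using hodge_dirac_add[OF assms(1) test_forms_scaleR[OF assms(2), of "-1"]]
    hodge_dirac_scaleR[OF assms(2), of "-1"] by simp

text \<open>Integration by parts in both terms of the Laplacian: \<open>ext_d_codiff_adjoint\<close>
  is applied to u with du, and to d*u with u.\<close>

lemma H1_seminorm_hodge_dirac:
  assumes u: "u \<in> test_forms \<Omega> (Suc k)"
  shows "H1_seminorm \<Omega> u = norm (hodge_dirac \<Omega> u)"
proof -
  note du = ext_d_test_forms[OF u] and cu = codiff_test_forms[OF u]
  note cdu = codiff_L2[OF du] and dcu = ext_d_L2[OF cu] and uL = test_forms_L2[OF \<Omega> u]
  have "laplace u = (\<lambda>x. codiff (ext_d u) x + ext_d (codiff u) x)"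
    by (rule ext) (rule laplace_def)
  then have "L2_inner \<Omega> (laplace u) u =
      lsq_of \<Omega> (codiff (ext_d u)) \<bullet> lsq_of \<Omega> u + lsq_of \<Omega> (ext_d (codiff u)) \<bullet> lsq_of \<Omega> u"
    using L2_inner_lsq_of[OF \<Omega> L2_add(1)[OF \<Omega> cdu dcu] uL] L2_add(2)[OF \<Omega> cdu dcu]
    by (simp add: inner_add_left)
  also have "\<dots> = L2_inner \<Omega> (ext_d u) (ext_d u) + L2_inner \<Omega> (codiff u) (codiff u)"
    using ext_d_codiff_adjoint[OF \<Omega> u du] ext_d_codiff_adjoint[OF \<Omega> cu u]
      L2_inner_lsq_of[OF \<Omega> uL cdu] L2_inner_lsq_of[OF \<Omega> dcu uL] by (simp add: inner_commute)
  also have "\<dots> = (norm (hodge_dirac \<Omega> u))\<^sup>2"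
    using L2_inner_lsq_of[OF \<Omega> codiff_L2[OF u] codiff_L2[OF u]]
      L2_inner_lsq_of[OF \<Omega> ext_d_L2[OF u] ext_d_L2[OF u]]
    by (simp add: hodge_dirac_def norm_prod_squared power2_norm_eq_inner)
  finally show ?thesis by (simp add: H1_seminorm_def)
qed

lemma H10_iff_Cauchy:
  "v \<in> H10 \<Omega> (Suc k) \<longleftrightarrow>
    (\<forall>m. v m \<in> test_forms \<Omega> (Suc k)) \<and> Cauchy (\<lambda>m. hodge_dirac \<Omega> (v m))"
proof -
  have "H1_seminorm \<Omega> (\<lambda>x. v i x - v j x) = dist (hodge_dirac \<Omega> (v i)) (hodge_dirac \<Omega> (v j))"
    if "\<forall>m. v m \<in> test_forms \<Omega> (Suc k)" for i j
  proof -
    have t: "v i \<in> test_forms \<Omega> (Suc k)" "v j \<in> test_forms \<Omega> (Suc k)" using that by auto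
    show ?thesis
      unfolding H1_seminorm_hodge_dirac[OF test_forms_diff[OF t]] hodge_dirac_diff[OF t] dist_norm ..
  qed
  then show ?thesis
    by (auto simp: H10_def Cauchy_def)
qed

lemma subspace_H10_image: "subspace (H10_image \<Omega> (Suc k))"
  unfolding H10_image_def
proof (rule closure_subspace_normed)
  let ?T = "test_forms \<Omega> (Suc k)"
  show "subspace (hodge_dirac \<Omega> ` ?T)"
    unfolding subspace_def
  proof (intro conjI ballI allI)
    have "0 = hodge_dirac \<Omega> (\<lambda>x. 0)"
      using hodge_dirac_scaleR[OF test_forms_zero[of \<Omega> "Suc k"], of 0] by simp
    then show "0 \<in> hodge_dirac \<Omega> ` ?T"
      using imageI[OF test_forms_zero[of \<Omega> "Suc k"], of "hodge_dirac \<Omega>"] by simp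
    fix x y c assume "x \<in> hodge_dirac \<Omega> ` ?T"
    then obtain u where u: "u \<in> ?T" "x = hodge_dirac \<Omega> u" by blast
    show "c *\<^sub>R x \<in> hodge_dirac \<Omega> ` ?T"
      unfolding u(2) hodge_dirac_scaleR[OF u(1), symmetric]
      by (rule imageI) (rule test_forms_scaleR[OF u(1)])
    assume "y \<in> hodge_dirac \<Omega> ` ?T"
    then obtain v where v: "v \<in> ?T" "y = hodge_dirac \<Omega> v" by blast
    show "x + y \<in> hodge_dirac \<Omega> ` ?T"
      unfolding u(2) v(2) hodge_dirac_add[OF u(1) v(1), symmetric]
      by (rule imageI) (rule test_forms_add[OF u(1) v(1)])
  qed
qed

lemma closed_H10_image: "closed (H10_image \<Omega> l)"
  by (simp add: H10_image_def)

text \<open>Holds for test forms and passes to the closure because the spaces of L2 forms are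
  closed.\<close>

lemma H10_image_components:
  "fst ` H10_image \<Omega> (Suc k) \<subseteq> lsq_of \<Omega> ` L2 \<Omega> k"
  "snd ` H10_image \<Omega> (Suc k) \<subseteq> lsq_of \<Omega> ` L2 \<Omega> (Suc (Suc k))"
proof -
  have "H10_image \<Omega> (Suc k) \<subseteq> lsq_of \<Omega> ` L2 \<Omega> k \<times> lsq_of \<Omega> ` L2 \<Omega> (Suc (Suc k))"
    unfolding H10_image_def
  proof (rule closure_minimal)
    show "hodge_dirac \<Omega> ` test_forms \<Omega> (Suc k) \<subseteq> lsq_of \<Omega> ` L2 \<Omega> k \<times> lsq_of \<Omega> ` L2 \<Omega> (Suc (Suc k))"
      using codiff_L2 ext_d_L2 by (auto simp: hodge_dirac_def)
    show "closed (lsq_of \<Omega> ` L2 \<Omega> k \<times> lsq_of \<Omega> ` L2 \<Omega> (Suc (Suc k)))"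
      by (intro closed_Times closed_lsq_of_L2 \<Omega>)
  qed
  then show "fst ` H10_image \<Omega> (Suc k) \<subseteq> lsq_of \<Omega> ` L2 \<Omega> k"
    "snd ` H10_image \<Omega> (Suc k) \<subseteq> lsq_of \<Omega> ` L2 \<Omega> (Suc (Suc k))"
    by auto
qed

section \<open>The continuous extensions of d and d* and the dual space\<close>

lemma L2_limit_choice:
  assumes f: "\<And>m. f m \<in> L2 \<Omega> k" and lim: "(\<lambda>m. lsq_of \<Omega> (f m)) \<longlonglongrightarrow> a"
    and w: "w \<in> L2 \<Omega> k \<and> (\<lambda>m. L2_norm \<Omega> (\<lambda>x. f m x - w x)) \<longlonglongrightarrow> 0"
  shows "lsq_of \<Omega> w = a"
proof -
  have "L2_norm \<Omega> (\<lambda>x. f m x - w x) = norm (lsq_of \<Omega> (f m) - lsq_of \<Omega> w)" for m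
    using w L2_norm_lsq_of[OF \<Omega> L2_diff(1)[OF \<Omega> f[of m]]] L2_diff(2)[OF \<Omega> f[of m]] by simp
  then have "(\<lambda>m. lsq_of \<Omega> (f m) - lsq_of \<Omega> w) \<longlonglongrightarrow> 0"
    using w by (auto intro: tendsto_norm_zero_cancel)
  then have "(\<lambda>m. lsq_of \<Omega> (f m)) \<longlonglongrightarrow> lsq_of \<Omega> w" by (rule LIM_zero_cancel)
  then show ?thesis using lim by (rule LIMSEQ_unique)
qed

text \<open>Justifies the choice in \<open>H10_d\<close> and \<open>H10_codiff\<close>: a limit form
  exists since the L2 forms are closed, and \<open>L2_limit_choice\<close> shows that every
  admissible choice has the same class.\<close>

lemma some_L2_limit:
  assumes f: "\<And>m. f m \<in> L2 \<Omega> k" and lim: "(\<lambda>m. lsq_of \<Omega> (f m)) \<longlonglongrightarrow> a"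
  defines "w \<equiv> SOME w. w \<in> L2 \<Omega> k \<and> (\<lambda>m. L2_norm \<Omega> (\<lambda>x. f m x - w x)) \<longlonglongrightarrow> 0"
  shows "w \<in> L2 \<Omega> k" "lsq_of \<Omega> w = a"
proof -
  have "a \<in> lsq_of \<Omega> ` L2 \<Omega> k"
    using closed_sequentially[OF closed_lsq_of_L2[OF \<Omega>] _ lim] f by blast
  then obtain b where b: "b \<in> L2 \<Omega> k" "a = lsq_of \<Omega> b" by blast
  have "L2_norm \<Omega> (\<lambda>x. f m x - b x) = norm (lsq_of \<Omega> (f m) - a)" for m
    using L2_norm_lsq_of[OF \<Omega> L2_diff(1)[OF \<Omega> f[of m] b(1)]] L2_diff(2)[OF \<Omega> f[of m] b(1)] b(2)
    by simp
  then have "(\<lambda>m. L2_norm \<Omega> (\<lambda>x. f m x - b x)) \<longlonglongrightarrow> 0"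
    using tendsto_norm_zero[OF LIM_zero[OF lim]] by simp
  with b(1) have "\<exists>w. w \<in> L2 \<Omega> k \<and> (\<lambda>m. L2_norm \<Omega> (\<lambda>x. f m x - w x)) \<longlonglongrightarrow> 0" by blast
  from someI_ex[OF this]
  have w: "w \<in> L2 \<Omega> k \<and> (\<lambda>m. L2_norm \<Omega> (\<lambda>x. f m x - w x)) \<longlonglongrightarrow> 0" unfolding w_def .
  then show "w \<in> L2 \<Omega> k" ..
  show "lsq_of \<Omega> w = a" by (rule L2_limit_choice[OF f lim w])
qed

text \<open>The dictionary between a representing sequence and its limit in the model: the extended
  operators become the coordinate projections and the norm becomes the product norm.\<close>

lemma H10_operators:
  assumes v: "v \<in> H10 \<Omega> (Suc k)" and lim: "(\<lambda>m. hodge_dirac \<Omega> (v m)) \<longlonglongrightarrow> z"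
  shows "H10_codiff \<Omega> (Suc k) v \<in> L2 \<Omega> k" "lsq_of \<Omega> (H10_codiff \<Omega> (Suc k) v) = fst z"
    "H10_d \<Omega> (Suc k) v \<in> L2 \<Omega> (Suc (Suc k))" "lsq_of \<Omega> (H10_d \<Omega> (Suc k) v) = snd z"
    "H10_norm \<Omega> v = norm z"
proof -
  have t: "v m \<in> test_forms \<Omega> (Suc k)" for m using v by (simp add: H10_iff_Cauchy)
  have l1: "(\<lambda>m. lsq_of \<Omega> (codiff (v m))) \<longlonglongrightarrow> fst z"
    and l2: "(\<lambda>m. lsq_of \<Omega> (ext_d (v m))) \<longlonglongrightarrow> snd z"
    using tendsto_fst[OF lim] tendsto_snd[OF lim] by (simp_all add: hodge_dirac_def)
  show "H10_codiff \<Omega> (Suc k) v \<in> L2 \<Omega> k" "lsq_of \<Omega> (H10_codiff \<Omega> (Suc k) v) = fst z"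
    using some_L2_limit[OF codiff_L2[OF t] l1] by (simp_all add: H10_codiff_def)
  show "H10_d \<Omega> (Suc k) v \<in> L2 \<Omega> (Suc (Suc k))" "lsq_of \<Omega> (H10_d \<Omega> (Suc k) v) = snd z"
    using some_L2_limit[OF ext_d_L2[OF t] l2] by (simp_all add: H10_d_def)
  have "H1_seminorm \<Omega> (v m) = norm (hodge_dirac \<Omega> (v m))" for m
    by (rule H1_seminorm_hodge_dirac[OF t])
  then show "H10_norm \<Omega> v = norm z"
    unfolding H10_norm_def using tendsto_norm[OF lim] by (simp add: limI)
qed

lemma H10_to_image:
  assumes "v \<in> H10 \<Omega> (Suc k)"
  shows "\<exists>z\<in>H10_image \<Omega> (Suc k). (\<lambda>m. hodge_dirac \<Omega> (v m)) \<longlonglongrightarrow> z"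
proof -
  from assms obtain z where z: "(\<lambda>m. hodge_dirac \<Omega> (v m)) \<longlonglongrightarrow> z"
    using Cauchy_convergent_iff convergent_def unfolding H10_iff_Cauchy by blast
  have "z \<in> H10_image \<Omega> (Suc k)"
    unfolding H10_image_def closure_sequential
    using assms z by (intro exI[of _ "\<lambda>m. hodge_dirac \<Omega> (v m)"]) (auto simp: H10_iff_Cauchy)
  with z show ?thesis by blast
qed

text \<open>With \<open>H10_to_image\<close> this lets quantifiers over representing sequences be
  exchanged for quantifiers over points of the closed subspace.\<close>

lemma H10_from_image:
  assumes "z \<in> H10_image \<Omega> (Suc k)"
  shows "\<exists>v\<in>H10 \<Omega> (Suc k). (\<lambda>m. hodge_dirac \<Omega> (v m)) \<longlonglongrightarrow> z"
proof -
  obtain y where y: "\<And>m. y m \<in> hodge_dirac \<Omega> ` test_forms \<Omega> (Suc k)" "y \<longlonglongrightarrow> z"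
    using assms unfolding H10_image_def closure_sequential by blast
  from y(1) have "\<forall>m. \<exists>u. u \<in> test_forms \<Omega> (Suc k) \<and> y m = hodge_dirac \<Omega> u" by blast
  then obtain v where v: "\<And>m. v m \<in> test_forms \<Omega> (Suc k)" "\<And>m. y m = hodge_dirac \<Omega> (v m)"
    by metis
  have yv: "y = (\<lambda>m. hodge_dirac \<Omega> (v m))" by (rule ext) (rule v(2))
  have "v \<in> H10 \<Omega> (Suc k)"
    using v(1) LIMSEQ_imp_Cauchy[OF y(2)] by (simp add: H10_iff_Cauchy yv)
  with y(2) show ?thesis unfolding yv by blast
qed

lemma Hm1_eq_iff:
  assumes h: "h \<in> L2 \<Omega> k" and g: "g \<in> L2 \<Omega> (Suc (Suc k))"
  shows "Hm1_d \<Omega> (Suc k) h = Hm1_codiff \<Omega> (Suc k) g \<longleftrightarrow>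
    (\<forall>z\<in>H10_image \<Omega> (Suc k). lsq_of \<Omega> h \<bullet> fst z = lsq_of \<Omega> g \<bullet> snd z)" (is "?L = ?R")
proof -
  have *: "L2_inner \<Omega> h (H10_codiff \<Omega> (Suc k) v) = lsq_of \<Omega> h \<bullet> fst z"
    "L2_inner \<Omega> g (H10_d \<Omega> (Suc k) v) = lsq_of \<Omega> g \<bullet> snd z"
    if "v \<in> H10 \<Omega> (Suc k)" "(\<lambda>m. hodge_dirac \<Omega> (v m)) \<longlonglongrightarrow> z" for v z
    using L2_inner_lsq_of[OF \<Omega> h H10_operators(1)[OF that]]
      L2_inner_lsq_of[OF \<Omega> g H10_operators(3)[OF that]] H10_operators(2,4)[OF that] by simp_all
  have L: "?L \<longleftrightarrow> (\<forall>v\<in>H10 \<Omega> (Suc k).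
      L2_inner \<Omega> h (H10_codiff \<Omega> (Suc k) v) = L2_inner \<Omega> g (H10_d \<Omega> (Suc k) v))"
    unfolding Hm1_d_def Hm1_codiff_def by (auto simp: fun_eq_iff restrict_def)
  show ?thesis
  proof
    assume ?L
    show ?R
    proof
      fix z assume "z \<in> H10_image \<Omega> (Suc k)"
      then obtain v where v: "v \<in> H10 \<Omega> (Suc k)" "(\<lambda>m. hodge_dirac \<Omega> (v m)) \<longlonglongrightarrow> z"
        using H10_from_image by blast
      show "lsq_of \<Omega> h \<bullet> fst z = lsq_of \<Omega> g \<bullet> snd z"
        using \<open>?L\<close> v(1) unfolding L *[OF v, symmetric] by blast
    qed
  next
    assume ?R
    show ?L
      unfolding L
    proof
      fix v assume v: "v \<in> H10 \<Omega> (Suc k)"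
      then obtain z where z: "z \<in> H10_image \<Omega> (Suc k)" "(\<lambda>m. hodge_dirac \<Omega> (v m)) \<longlonglongrightarrow> z"
        using H10_to_image by blast
      show "L2_inner \<Omega> h (H10_codiff \<Omega> (Suc k) v) = L2_inner \<Omega> g (H10_d \<Omega> (Suc k) v)"
        unfolding *[OF v z(2)] using \<open>?R\<close> z(1) by blast
    qed
  qed
qed

text \<open>Presents the kernel condition in \<open>M_space\<close> as the case g = 0 of
  \<open>Hm1_eq_iff\<close>.\<close>

lemma Hm1_codiff_zero: "Hm1_codiff \<Omega> l (\<lambda>x. 0) = (\<lambda>v\<in>H10 \<Omega> l. 0)"
  by (simp add: Hm1_codiff_def L2_inner_def)

lemma M_space_lsq_of:
  "lsq_of \<Omega> ` M_space \<Omega> (Suc k) =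
    annihilator_complement (lsq_of \<Omega> ` L2 \<Omega> k) (H10_image \<Omega> (Suc k))"
proof -
  have ker: "Hm1_d \<Omega> (Suc k) h = (\<lambda>v\<in>H10 \<Omega> (Suc k). 0) \<longleftrightarrow>
      (\<forall>z\<in>H10_image \<Omega> (Suc k). lsq_of \<Omega> h \<bullet> fst z = 0)" if "h \<in> L2 \<Omega> k" for h
    using Hm1_eq_iff[OF that L2_zero] by (simp add: Hm1_codiff_zero lsq_of_zero)
  show ?thesis
    unfolding M_space_def annihilator_complement_def using ker L2_inner_lsq_of[OF \<Omega>]
    by (auto simp: image_iff)
qed

section \<open>The two bounds translated to the Hilbert space model\<close>

lemma L2_of_M_space: "q \<in> M_space \<Omega> (Suc k) \<Longrightarrow> q \<in> L2 \<Omega> k"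
  by (simp add: M_space_def)

lemma babuska_aziz_bound_iff:
  "(\<forall>q\<in>M_space \<Omega> (Suc k). \<exists>v\<in>H10 \<Omega> (Suc k).
       (AE x in lebesgue_on \<Omega>. H10_codiff \<Omega> (Suc k) v x = q x) \<and>
       (H10_norm \<Omega> v)\<^sup>2 \<le> C * (L2_norm \<Omega> q)\<^sup>2) \<longleftrightarrow>
    ba_bound (lsq_of \<Omega> ` L2 \<Omega> k) (H10_image \<Omega> (Suc k)) C"
proof -
  have "(\<exists>v\<in>H10 \<Omega> (Suc k). (AE x in lebesgue_on \<Omega>. H10_codiff \<Omega> (Suc k) v x = q x) \<and>
       (H10_norm \<Omega> v)\<^sup>2 \<le> C * (L2_norm \<Omega> q)\<^sup>2) \<longleftrightarrow>
     (\<exists>z\<in>H10_image \<Omega> (Suc k). fst z = lsq_of \<Omega> q \<and> (norm z)\<^sup>2 \<le> C * (norm (lsq_of \<Omega> q))\<^sup>2)"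
    (is "(\<exists>v\<in>_. ?P v) \<longleftrightarrow> (\<exists>z\<in>_. ?Q z)") if q: "q \<in> M_space \<Omega> (Suc k)" for q
  proof -
    \<comment> \<open>Equality almost everywhere in \<Omega> is equality of classes, so the two
      conditions agree for a sequence and its limit.\<close>
    have PQ: "?P v \<longleftrightarrow> ?Q z"
      if v: "v \<in> H10 \<Omega> (Suc k)" "(\<lambda>m. hodge_dirac \<Omega> (v m)) \<longlonglongrightarrow> z" for v z
      using lsq_of_eq_iff[OF \<Omega> H10_operators(1)[OF v] L2_of_M_space[OF q]] H10_operators[OF v]
        L2_norm_lsq_of[OF \<Omega> L2_of_M_space[OF q]] by simp
    show ?thesis
    proof
      assume "\<exists>v\<in>H10 \<Omega> (Suc k). ?P v"
      then show "\<exists>z\<in>H10_image \<Omega> (Suc k). ?Q z" using PQ H10_to_image by blast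
    next
      assume "\<exists>z\<in>H10_image \<Omega> (Suc k). ?Q z"
      then show "\<exists>v\<in>H10 \<Omega> (Suc k). ?P v" using PQ H10_from_image by blast
    qed
  qed
  then show ?thesis
    unfolding ba_bound_def M_space_lsq_of[symmetric] by (simp cong: ball_cong)
qed

lemma friedrichs_velte_bound_iff:
  "(\<forall>h\<in>M_space \<Omega> (Suc k). \<forall>g\<in>L2 \<Omega> (Suc (Suc k)).
       Hm1_d \<Omega> (Suc k) h = Hm1_codiff \<Omega> (Suc k) g \<longrightarrow>
       (L2_norm \<Omega> h)\<^sup>2 \<le> \<Gamma> * (L2_norm \<Omega> g)\<^sup>2) \<longleftrightarrow>
    fv_bound (lsq_of \<Omega> ` L2 \<Omega> k) (lsq_of \<Omega> ` L2 \<Omega> (Suc (Suc k))) (H10_image \<Omega> (Suc k)) \<Gamma>"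
proof -
  have "(Hm1_d \<Omega> (Suc k) h = Hm1_codiff \<Omega> (Suc k) g \<longrightarrow>
       (L2_norm \<Omega> h)\<^sup>2 \<le> \<Gamma> * (L2_norm \<Omega> g)\<^sup>2) \<longleftrightarrow>
     ((\<forall>z\<in>H10_image \<Omega> (Suc k). lsq_of \<Omega> h \<bullet> fst z = lsq_of \<Omega> g \<bullet> snd z) \<longrightarrow>
       (norm (lsq_of \<Omega> h))\<^sup>2 \<le> \<Gamma> * (norm (lsq_of \<Omega> g))\<^sup>2)"
    if h: "h \<in> M_space \<Omega> (Suc k)" and g: "g \<in> L2 \<Omega> (Suc (Suc k))" for h g
    unfolding Hm1_eq_iff[OF L2_of_M_space[OF h] g] L2_norm_lsq_of[OF \<Omega> g]
      L2_norm_lsq_of[OF \<Omega> L2_of_M_space[OF h]] ..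
  then show ?thesis
    unfolding fv_bound_def M_space_lsq_of[symmetric] by (simp cong: ball_cong)
qed

section \<open>Nonzero elements that restrict the admissible constants\<close>

lemma exists_nonzero_annihilator_complement:
  assumes "\<Omega> \<noteq> {}" "Suc k \<le> CARD('n)"
  shows "\<exists>q\<in>annihilator_complement (lsq_of \<Omega> ` L2 \<Omega> k) (H10_image \<Omega> (Suc k)). q \<noteq> 0"
proof -
  obtain u x where u: "u \<in> test_forms \<Omega> (Suc k)" and x: "x \<in> \<Omega>" "codiff u x \<noteq> 0"
    using exists_test_form_codiff_nonzero[OF \<Omega> assms] by blast
  have z: "hodge_dirac \<Omega> u \<in> H10_image \<Omega> (Suc k)"
    unfolding H10_image_def by (rule subsetD[OF closure_subset imageI[OF u]])
  \<comment> \<open>The codifferential of a test form is orthogonal to the kernel of d, since that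
    kernel is defined by testing against such codifferentials and their limits.\<close>
  have "fst (hodge_dirac \<Omega> u) \<in> annihilator_complement (lsq_of \<Omega> ` L2 \<Omega> k) (H10_image \<Omega> (Suc k))"
    using z H10_image_components(1)[of k] unfolding annihilator_complement_def
    by (auto simp: inner_commute)
  moreover have "fst (hodge_dirac \<Omega> u) \<noteq> 0"
  proof
    assume "fst (hodge_dirac \<Omega> u) = 0"
    then have "lsq_of \<Omega> (codiff u) = lsq_of \<Omega> (\<lambda>x. 0)"
      by (simp add: hodge_dirac_def lsq_of_zero)
    then have "AE x in lebesgue_on \<Omega>. codiff u x = 0"
      using lsq_of_eq_iff[OF \<Omega> codiff_L2[OF u] L2_zero] by simp
    then have "AE x in lebesgue. x \<in> \<Omega> \<longrightarrow> codiff u x = 0"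
      using AE_restrict_space_iff[of \<Omega> lebesgue "\<lambda>x. codiff u x = 0"] \<Omega> by simp
    then have AE: "AE x in lebesgue. x \<notin> {x \<in> \<Omega>. codiff u x \<noteq> 0}"
      by (rule AE_mp) (rule AE_I2, simp)
    \<comment> \<open>By continuity the set where the codifferential is nonzero is open; it meets
      \<Omega>, so it cannot be a null set there.\<close>
    have "open {x. codiff u x \<noteq> 0}"
      by (intro open_Collect_neq continuous_on_const test_formsD(3)[OF codiff_test_forms[OF u]])
    then have op: "open {x \<in> \<Omega>. codiff u x \<noteq> 0}"
      using open_Int[OF \<Omega>] by (simp add: Collect_conj_eq)
    with AE have "negligible {x \<in> \<Omega>. codiff u x \<noteq> 0}"
      using AE_iff_null_sets[of "{x \<in> \<Omega>. codiff u x \<noteq> 0}" lebesgue]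
      by (simp add: negligible_iff_null_sets)
    moreover have "{x \<in> \<Omega>. codiff u x \<noteq> 0} \<noteq> {}" using x by blast
    ultimately show False using open_not_negligible[OF op] by blast
  qed
  ultimately show ?thesis by blast
qed

end

text \<open>c \<bullet> du is a sum of partial derivatives of the compactly supported functions c
  \<bullet> (dx_j \<and> u), and these integrate to zero. \<open>ext_d_codiff_adjoint\<close> does
  not cover this, as it asks for test forms on both sides.\<close>

lemma constant_form_orthogonal:
  fixes \<Omega> :: "(real^'n::{finite,linorder}) set" and c :: "real^('n set)"
  assumes \<Omega>: "open \<Omega>" and u: "u \<in> test_forms \<Omega> k"
  shows "L2_inner \<Omega> (\<lambda>x. c) (ext_d u) = 0"
proof -
  have "L2_inner \<Omega> (\<lambda>x. c) (ext_d u) = (\<integral>x. indicator \<Omega> x *\<^sub>R (c \<bullet> ext_d u x) \<partial>lebesgue)"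
    unfolding L2_inner_def using \<Omega> by (intro integral_restrict_space) simp
  also have "(\<lambda>x. indicator \<Omega> x *\<^sub>R (c \<bullet> ext_d u x)) = (\<lambda>x. c \<bullet> ext_d u x)"
  proof
    fix x
    show "indicator \<Omega> x *\<^sub>R (c \<bullet> ext_d u x) = c \<bullet> ext_d u x"
    proof (cases "x \<in> \<Omega>")
      case False
      then have "x \<notin> closure {x. ext_d u x \<noteq> 0}"
        using test_formsD(6)[OF ext_d_test_forms[OF u]] by blast
      from test_forms_outside[OF this] show ?thesis by simp
    qed simp
  qed
  also have "(\<integral>x. c \<bullet> ext_d u x \<partial>lebesgue) = (\<integral>x. c \<bullet> ext_d u x \<partial>lborel)"
    by (intro integral_completion)
      (simp add: borel_measurable_continuous_onI continuous_on_inner continuous_on_const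
        test_formsD(3)[OF ext_d_test_forms[OF u]])
  also have "\<dots> = 0"
  proof -
    have blin: "bounded_linear (\<lambda>w. c \<bullet> dx_wedge j w)" for j
      using bounded_linear_compose[OF bounded_linear_inner_right, of "dx_wedge j" c]
        linear_dx_wedge[of j] by (simp add: linear_conv_bounded_linear)
    define f where "f j x = c \<bullet> dx_wedge j (u x)" for j x
    have Cf: "Ck m (f j)" for m j
      unfolding f_def by (rule Ck_bounded_linear[OF blin test_formsD(1)[OF u]])
    have pf: "partial j (f j) x = c \<bullet> dx_wedge j (partial j u x)" for j x
      unfolding f_def by (rule partial_bounded_linear[OF blin test_formsD(2)[OF u]])
    let ?S = "closure {x. u x \<noteq> 0}"
    have sub: "{x. f j x \<noteq> 0} \<subseteq> {x. u x \<noteq> 0}" for j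
      by (auto simp: f_def linear_0[OF linear_dx_wedge])
    have comp: "compact (closure {x. f j x \<noteq> 0})" for j
    proof -
      have "?S \<inter> closure {x. f j x \<noteq> 0} = closure {x. f j x \<noteq> 0}"
        using closure_mono[OF sub] by blast
      then show ?thesis
        using compact_Int_closed[OF test_formsD(5)[OF u] closed_closure[of "{x. f j x \<noteq> 0}"]]
        by (simp del: compact_closure)
    qed
    have cont: "continuous_on UNIV (partial j (f j))" for j
      using Cf[of 1 j] by simp
    have "(\<integral>x. partial j (f j) x \<partial>lborel) = 0" for j
      using Cf[of 1 j] cont comp by (intro integral_partial_eq_0) auto
    moreover have "integrable lborel (partial j (f j))" for j
      by (rule integrable_continuous_compact_support[OF cont comp partial_eq_0_outside])
    moreover have "c \<bullet> ext_d u x = (\<Sum>j\<in>UNIV. partial j (f j) x)" for x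
      by (simp add: ext_d_def pf inner_sum_right)
    ultimately show ?thesis by simp
  qed
  finally show ?thesis .
qed

text \<open>A constant form of degree l + 1 serves. Combined with h = 0 in the Friedrichs-Velte
  inequality it excludes negative constants.\<close>

lemma exists_nonzero_coclosed:
  fixes \<Omega> :: "(real^'n::{finite,linorder}) set"
  assumes \<Omega>: "open \<Omega>" "bounded \<Omega>" "\<Omega> \<noteq> {}" and k: "Suc (Suc k) \<le> CARD('n)"
  shows "\<exists>g\<in>lsq_of \<Omega> ` L2 \<Omega> (Suc (Suc k)). g \<noteq> 0 \<and> (\<forall>z\<in>H10_image \<Omega> (Suc k). g \<bullet> snd z = 0)"
proof -
  obtain J :: "'n set" where J: "card J = Suc (Suc k)"
    using obtain_subset_with_card_n[OF k] by metis
  define c :: "real^('n set)" where "c = axis J 1"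
  have c0: "c \<noteq> 0" by (simp add: c_def axis_eq_0_iff)
  have fin: "emeasure lebesgue \<Omega> < \<infinity>"
    using emeasure_bounded_finite[OF \<Omega>(2)] \<Omega>(1) by simp
  have cL: "(\<lambda>x. c) \<in> L2 \<Omega> (Suc (Suc k))"
  proof -
    \<comment> \<open>Boundedness of \<Omega> enters here: constants are square integrable on a set
      of finite measure.\<close>
    have "finite_measure (lebesgue_on \<Omega>)"
      using fin \<Omega>(1) by (intro finite_measureI) (simp add: emeasure_restrict_space space_restrict_space)
    then have "integrable (lebesgue_on \<Omega>) (\<lambda>x. (norm c)\<^sup>2)"
      by (rule finite_measure.integrable_const)
    then show ?thesis using J by (auto simp: L2_def Lam_def c_def axis_def)
  qed
  have "lsq_of \<Omega> (\<lambda>x. c) \<noteq> 0"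
  proof
    assume "lsq_of \<Omega> (\<lambda>x. c) = 0"
    then have "AE x in lebesgue_on \<Omega>. c = 0"
      using lsq_of_eq_iff[OF \<Omega>(1) cL L2_zero] by (simp add: lsq_of_zero)
    then have "AE x in lebesgue. x \<in> \<Omega> \<longrightarrow> False"
      using AE_restrict_space_iff[of \<Omega> lebesgue "\<lambda>x. c = 0"] \<Omega>(1) c0 by simp
    then have "negligible \<Omega>"
      using AE_iff_null_sets[of \<Omega> lebesgue] \<Omega>(1) by (simp add: negligible_iff_null_sets)
    then show False using open_not_negligible[OF \<Omega>(1,3)] by blast
  qed
  moreover have "lsq_of \<Omega> (\<lambda>x. c) \<bullet> snd z = 0" if "z \<in> H10_image \<Omega> (Suc k)" for z
  proof -
    \<comment> \<open>Orthogonality is a closed condition, so it extends from test forms to their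
      closure.\<close>
    have "closed {z. lsq_of \<Omega> (\<lambda>x. c) \<bullet> snd z = 0}"
      by (intro closed_Collect_eq continuous_intros)
    moreover have "hodge_dirac \<Omega> ` test_forms \<Omega> (Suc k) \<subseteq> {z. lsq_of \<Omega> (\<lambda>x. c) \<bullet> snd z = 0}"
      using constant_form_orthogonal[OF \<Omega>(1)] L2_inner_lsq_of[OF \<Omega>(1) cL ext_d_L2[OF \<Omega>(1)]]
      by (auto simp: hodge_dirac_def)
    ultimately show ?thesis
      using that closure_minimal unfolding H10_image_def by blast
  qed
  ultimately show ?thesis using cL by blast
qed

section \<open>From admissible bounds to the smallest constants\<close>

lemma Inf_ereal_shift:
  fixes P Q :: "real \<Rightarrow> bool"
  assumes "\<And>C. P C \<longleftrightarrow> Q (C - 1)"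
  shows "Inf {ereal C | C. P C} = Inf {ereal C | C. Q C} + 1"
proof (rule antisym)
  show "Inf {ereal C | C. Q C} + 1 \<le> Inf {ereal C | C. P C}"
  proof (rule Inf_greatest, clarify)
    fix C assume "P C"
    then have "Inf {ereal C | C. Q C} \<le> ereal (C - 1)"
      using assms by (intro Inf_lower) blast
    then have "Inf {ereal C | C. Q C} + 1 \<le> ereal (C - 1) + 1" by (rule add_right_mono)
    then show "Inf {ereal C | C. Q C} + 1 \<le> ereal C" by (simp add: one_ereal_def)
  qed
  \<comment> \<open>The 1 is moved to the left so that \<open>Inf_greatest\<close> applies; being
    finite, it can be moved back afterwards even if an infimum is infinite.\<close>
  have "Inf {ereal C | C. P C} - 1 \<le> Inf {ereal C | C. Q C}"
  proof (rule Inf_greatest, clarify)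
    fix C assume "Q C"
    then have "Inf {ereal C | C. P C} \<le> ereal (C + 1)"
      using assms[of "C + 1"] by (intro Inf_lower) auto
    then show "Inf {ereal C | C. P C} - 1 \<le> ereal C"
      by (simp add: ereal_minus_le one_ereal_def)
  qed
  then show "Inf {ereal C | C. P C} \<le> Inf {ereal C | C. Q C} + 1"
    by (simp add: ereal_minus_le)
qed

theorem theorem2p1:
  fixes \<Omega> :: "(real^'n::{finite,linorder}) set"
    and l :: nat
  assumes "CARD('n) \<ge> 2"
    and "open \<Omega>" and "bounded \<Omega>" and "\<Omega> \<noteq> {}"
    and "1 \<le> l" and "l \<le> CARD('n) - 1"
  shows "(\<bar>babuska_aziz_const \<Omega> l\<bar> \<noteq> \<infinity> \<longleftrightarrow> \<bar>friedrichs_velte_const \<Omega> l\<bar> \<noteq> \<infinity>) \<and>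
         babuska_aziz_const \<Omega> l = friedrichs_velte_const \<Omega> l + 1"
proof -
  obtain k where l: "l = Suc k" using assms(5) by (cases l) auto
  have k: "Suc k \<le> CARD('n)" "Suc (Suc k) \<le> CARD('n)" using assms(1,6) l by auto
  let ?U = "lsq_of \<Omega> ` L2 \<Omega> k" and ?W = "lsq_of \<Omega> ` L2 \<Omega> (Suc (Suc k))"
  let ?K = "H10_image \<Omega> (Suc k)"
  \<comment> \<open>An equivalence for every real \<open>C\<close>, so the two sets of admissible
    constants are translates of each other by 1, including the case that both are empty.\<close>
  have iff: "ba_bound ?U ?K C \<longleftrightarrow> fv_bound ?U ?W ?K (C - 1)" for C
  proof
    assume ba: "ba_bound ?U ?K C"
    obtain q where "q \<in> annihilator_complement ?U ?K" "q \<noteq> 0"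
      using exists_nonzero_annihilator_complement[OF assms(2,4) k(1)] by blast
    then show "fv_bound ?U ?W ?K (C - 1)" by (rule ba_bound_imp_fv_bound[OF ba])
  next
    assume fv: "fv_bound ?U ?W ?K (C - 1)"
    obtain g where g: "g \<in> ?W" "g \<noteq> 0" "\<forall>z\<in>?K. g \<bullet> snd z = 0"
      using exists_nonzero_coclosed[OF assms(2,3,4) k(2)] by blast
    have "0 \<in> annihilator_complement ?U ?K"
      using subspace_0[OF subspace_lsq_of_L2[OF assms(2)]] by (simp add: annihilator_complement_def)
    \<comment> \<open>The pair (0, g) satisfies the premise because both sides vanish on the model,
      so the inequality reads 0 \<le> (C - 1) |g|^2.\<close>
    with fv g have "(norm (0 :: 'n lsq_form))\<^sup>2 \<le> (C - 1) * (norm g)\<^sup>2"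
      unfolding fv_bound_def by (metis inner_zero_left)
    then have "0 \<le> C - 1" using g(2) by (simp add: zero_le_mult_iff)
    from fv_bound_imp_ba_bound[OF fv this subspace_lsq_of_L2[OF assms(2)] closed_lsq_of_L2[OF assms(2)]
        subspace_H10_image[OF assms(2)] closed_H10_image[OF assms(2)] H10_image_components[OF assms(2)]]
    show "ba_bound ?U ?K C" by simp
  qed
  have "babuska_aziz_const \<Omega> l = friedrichs_velte_const \<Omega> l + 1"
    unfolding babuska_aziz_const_def friedrichs_velte_const_def l
    using babuska_aziz_bound_iff[OF assms(2)] friedrichs_velte_bound_iff[OF assms(2)] iff
    by (intro Inf_ereal_shift) simp
  \<comment> \<open>Adding 1 neither creates nor removes an infinite value, which gives the
    equivalence of finiteness.\<close>
  then show ?thesis by (cases "friedrichs_velte_const \<Omega> l") (auto simp: one_ereal_def)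
qed

end
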